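(* Let $\Phi$ be a unital commutative ring containing $\frac12$ and let $V$ be a nondegenerate Jordan pair over $\Phi$. Then the extended centroid $\mathcal{C}(V)$ of $V$ is isomorphic (as a ring) to the extended centroid $\mathcal{C}(TKK(V))$ of its Tits-Kantor-Koecher algebra $TKK(V)$.
   Context: A Jordan pair $V=(V^+,V^-)$ over $\Phi$ has products $Q_xy$ ($x\in V^\sigma,y\in V^{-\sigma}$, $\sigma=\pm$) with linearizations $\{x,y,z\}=D_{x,y}z=Q_{x+z}y-Q_xy-Q_zy$. $V$ is nondegenerate if $Q_x=0$ implies $x=0$, for $x\in V^\sigma$. An ideal (of a Jordan pair or Lie algebra) is essential if it has nonzero intersection with every nonzero ideal. $TKK(V)=V^+\oplus\mathrm{IDer}\,V\oplus V^-$ (3-graded with degrees $1,0,-1$), where $\mathrm{IDer}\,V$ is spanned by the derivations $\delta(x,y)=(D_{x,y},-D_{y,x})$ for $x\in V^+,y\in V^-$; the bracket satisfies $[V^\sigma,V^\sigma]=0$, $[x,y]=\delta(x,y)$ for $x\in V^+,y\in V^-$, $\mathrm{IDer}\,V$ acts naturally on $V^\pm$ and has the commutator product. Extended centroid of a semiprime Lie algebra $L$ (TKK-algebras of nondegenerate Jordan pairs are nondegenerate, hence semiprime): a permissible map is a pair $(f,I)$ with $I$ an essential ideal of $L$ and $f:I\to L$ an additive map with $f([x,y])=[x,f(y)]$ for $x\in L$, $y\in I$. Two are equivalent if they agree on some essential ideal contained in both domains. $\mathcal{C}(L)$ is the set of classes $\overline{(f,I)}$, with sum induced by $f_1+f_2$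 on $I_1\cap I_2$ and product induced by $f_1f_2$ on $f_2^{-1}(I_1)$. Extended centroid of a nondegenerate Jordan pair $V$: for an ideal $U=(U^+,U^-)$ of $V$, a $V$-homomorphism $g=(g^+,g^-):U\to V$ is a pair of linear maps $g^\sigma:U^\sigma\to V^\sigma$ such that for $\sigma=\pm$, $y^\sigma\in U^\sigma$, $x^\sigma,z^\sigma\in V^\sigma$: (a) $g^\sigma(Q_{x^\sigma}y^{-\sigma})=Q_{x^\sigma}g^{-\sigma}(y^{-\sigma})$; (b) $g^\sigma(Q_{U^\sigma}V^{-\sigma})\subseteq U^\sigma$ and $(g^\sigma)^2(Q_{y^\sigma}x^{-\sigma})=Q_{g^\sigma(y^\sigma)}x^{-\sigma}$; (c) $g^\sigma(\{y^\sigma,z^{-\sigma},x^\sigma\})=\{g^\sigma(y^\sigma),z^{-\sigma},x^\sigma\}$. A permissible map of $V$ is a pair $(g,U)$ with $U$ an essential ideal of $V$ and $g:U\to V$ a $V$-homomorphism. Two are equivalent if they agree on some essential ideal contained in both domains. $\mathcal{C}(V)$ is the set of classes $[g,U]$. For ideals $I,K$ of $V$ let $K\ast I=(Q_{K^+}I^-+Q_{V^+}Q_{K^-}I^+,\ Q_{K^-}I^++Q_{V^-}Q_{K^+}I^-)$, an ideal of $V$. Operations: $[g_1,U_1]+[g_2,U_2]=[g_1+g_2,K]$ and $[g_1,U_1][g_2,U_2]=[g_1g_2,K\ast V]$, where $K=(U_1\cap U_2)\ast V$ (an essential ideal) and the maps are restricted to the indicated ideals. With these operations $\mathcal{C}(V)$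 is a commutative associative unital ring. *)

theory Defs
  imports Complex_Main "HOL-Algebra.QuotRing" "HOL-Library.Function_Algebras" "HOL-Library.Product_Plus"
begin

definition jp_triple :: "('a::ab_group_add \<Rightarrow> 'b \<Rightarrow> 'a) \<Rightarrow> 'a \<Rightarrow> 'b \<Rightarrow> 'a \<Rightarrow> 'a"
  where "jp_triple Q x y z = Q (x + z) y - Q x y - Q z y"

text \<open>\<open>Q x y\<close> is linear in \<open>y\<close> and quadratic in \<open>x\<close>. Linearity of \<open>{x, y, z}\<close> in \<open>z\<close>
  follows by symmetry.\<close>

definition quadratic_product ::
  "('r::comm_ring_1 \<Rightarrow> 'a::ab_group_add \<Rightarrow> 'a) \<Rightarrow> ('r \<Rightarrow> 'b::ab_group_add \<Rightarrow> 'b) \<Rightarrow>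
    ('a \<Rightarrow> 'b \<Rightarrow> 'a) \<Rightarrow> bool"
  where "quadratic_product s s' Q \<longleftrightarrow>
    (\<forall>x. module_hom s' s (Q x)) \<and>
    (\<forall>c x y. Q (s c x) y = s (c^2) (Q x y)) \<and>
    (\<forall>x x' y z. jp_triple Q (x + x') y z = jp_triple Q x y z + jp_triple Q x' y z) \<and>
    (\<forall>c x y z. jp_triple Q (s c x) y z = s c (jp_triple Q x y z))"

text \<open>Loos' axioms JP1, JP2, JP3 are required to hold strictly, that is, in all scalar extensions,
  or equivalently together with all their linearizations. The linearizations that are not
  automatic are added explicitly: the component of JP1 of degree \<open>(2, 1)\<close> and the components of
  JP3 of degrees \<open>(3, 1)\<close> and \<open>(2, 2)\<close> in \<open>(x, w)\<close>. The remaining ones, including those with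
  respect to variables of degree 2, are differences of values of these.
  The axioms below are the ones for \<open>x\<close> in one of the two modules; a Jordan pair satisfies them
  for both orders of its two products.\<close>

definition jp_identities ::
  "('a::ab_group_add \<Rightarrow> 'b::ab_group_add \<Rightarrow> 'a) \<Rightarrow> ('b \<Rightarrow> 'a \<Rightarrow> 'b) \<Rightarrow> bool"
  where "jp_identities Q Q' \<longleftrightarrow>
    (let T = jp_triple Q; T' = jp_triple Q' in
      (\<forall>x y z. T x y (Q x z) = Q x (T' y x z)) \<and>
      (\<forall>x w y z. T w y (Q x z) + T x y (T x z w) = T x (T' y x z) w + Q x (T' y w z)) \<and>
      (\<forall>x y z. T (Q x y) y z = T x (Q' y x) z) \<and>
      (\<forall>x y z. Q (Q x y) z = Q x (Q' y (Q x z))) \<and>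
      (\<forall>x w y z. T (Q x y) z (T x y w) = Q x (Q' y (T x z w)) + T x (Q' y (Q x z)) w) \<and>
      (\<forall>x w y z. Q (T x y w) z + T (Q x y) z (Q w y) =
        Q x (Q' y (Q w z)) + Q w (Q' y (Q x z)) + T x (Q' y (T x z w)) w))"

definition jp_absorbs ::
  "('a::ab_group_add \<Rightarrow> 'b \<Rightarrow> 'a) \<Rightarrow> 'a set \<Rightarrow> 'b set \<Rightarrow> bool"
  where "jp_absorbs Q U U' \<longleftrightarrow>
    (\<forall>u\<in>U. \<forall>y. Q u y \<in> U) \<and> (\<forall>x. \<forall>u\<in>U'. Q x u \<in> U) \<and> (\<forall>x y. \<forall>u\<in>U. jp_triple Q x y u \<in> U)"

text \<open>A module homomorphism defined on the submodule \<open>U\<close>; nothing is said about the values of the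
  total function \<open>g\<close> outside \<open>U\<close>.\<close>

definition linear_on_submodule ::
  "('r \<Rightarrow> 'a::plus \<Rightarrow> 'a) \<Rightarrow> 'a set \<Rightarrow> ('a \<Rightarrow> 'a) \<Rightarrow> bool"
  where "linear_on_submodule s U g \<longleftrightarrow>
    (\<forall>x\<in>U. \<forall>y\<in>U. g (x + y) = g x + g y) \<and> (\<forall>c. \<forall>x\<in>U. g (s c x) = s c (g x))"

definition jp_hom_conditions ::
  "('a::ab_group_add \<Rightarrow> 'b \<Rightarrow> 'a) \<Rightarrow> 'a set \<Rightarrow> 'b set \<Rightarrow> ('a \<Rightarrow> 'a) \<Rightarrow> ('b \<Rightarrow> 'b) \<Rightarrow> bool"
  where "jp_hom_conditions Q U U' g g' \<longleftrightarrow>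
    (\<forall>x. \<forall>y\<in>U'. g (Q x y) = Q x (g' y)) \<and>
    (\<forall>y\<in>U. \<forall>x. g (Q y x) \<in> U \<and> g (g (Q y x)) = Q (g y) x) \<and>
    (\<forall>y\<in>U. \<forall>z x. g (jp_triple Q y z x) = jp_triple Q (g y) z x)"

text \<open>A permissible map \<open>((g\<^sup>+, g\<^sup>-), (U\<^sup>+, U\<^sup>-))\<close>. Values outside the domain are irrelevant,
  since the equivalence of permissible maps only compares values on the domains.\<close>

type_synonym ('a, 'b) jp_map =
  "(('a \<Rightarrow> 'a) \<times> ('b \<Rightarrow> 'b)) \<times> ('a set \<times> 'b set)"

locale jordan_pair = P: module sp + M: module sm
  for sp :: "'r::comm_ring_1 \<Rightarrow> 'a::ab_group_add \<Rightarrow> 'a"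
    and sm :: "'r \<Rightarrow> 'b::ab_group_add \<Rightarrow> 'b" +
  fixes Qp :: "'a \<Rightarrow> 'b \<Rightarrow> 'a"
    and Qm :: "'b \<Rightarrow> 'a \<Rightarrow> 'b"
  assumes quadratic_p: "quadratic_product sp sm Qp"
    and quadratic_m: "quadratic_product sm sp Qm"
    and identities_p: "jp_identities Qp Qm"
    and identities_m: "jp_identities Qm Qp"
begin

abbreviation Tp :: "'a \<Rightarrow> 'b \<Rightarrow> 'a \<Rightarrow> 'a" where "Tp \<equiv> jp_triple Qp"
abbreviation Tm :: "'b \<Rightarrow> 'a \<Rightarrow> 'b \<Rightarrow> 'b" where "Tm \<equiv> jp_triple Qm"

definition jp_ideal :: "'a set \<times> 'b set \<Rightarrow> bool"
  where "jp_ideal = (\<lambda>(Up, Um).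
    P.subspace Up \<and> M.subspace Um \<and> jp_absorbs Qp Up Um \<and> jp_absorbs Qm Um Up)"

definition jp_inter :: "'a set \<times> 'b set \<Rightarrow> 'a set \<times> 'b set \<Rightarrow> 'a set \<times> 'b set"
  where "jp_inter = (\<lambda>(Up, Um) (Wp, Wm). (Up \<inter> Wp, Um \<inter> Wm))"

definition essential_jp_ideal :: "'a set \<times> 'b set \<Rightarrow> bool"
  where "essential_jp_ideal U \<longleftrightarrow> jp_ideal U \<and>
    (\<forall>W. jp_ideal W \<and> W \<noteq> ({0}, {0}) \<longrightarrow> jp_inter U W \<noteq> ({0}, {0}))"

definition jp_star :: "'a set \<times> 'b set \<Rightarrow> 'a set \<times> 'b set \<Rightarrow> 'a set \<times> 'b set"
  where "jp_star = (\<lambda>(Kp, Km) (Ip, Im).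
    (P.span ({Qp k i | k i. k \<in> Kp \<and> i \<in> Im} \<union> {Qp v (Qm k i) | v k i. k \<in> Km \<and> i \<in> Ip}),
     M.span ({Qm k i | k i. k \<in> Km \<and> i \<in> Ip} \<union> {Qm v (Qp k i) | v k i. k \<in> Kp \<and> i \<in> Im})))"

definition jp_permissible :: "('a, 'b) jp_map set"
  where "jp_permissible = {((gp, gm), (Up, Um)).
    essential_jp_ideal (Up, Um) \<and>
    linear_on_submodule sp Up gp \<and> linear_on_submodule sm Um gm \<and>
    jp_hom_conditions Qp Up Um gp gm \<and> jp_hom_conditions Qm Um Up gm gp}"

definition jp_map_equiv :: "(('a, 'b) jp_map \<times> ('a, 'b) jp_map) set"
  where "jp_map_equiv = {(((gp, gm), (Up, Um)), ((hp, hm), (Wp, Wm))).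
    ((gp, gm), (Up, Um)) \<in> jp_permissible \<and> ((hp, hm), (Wp, Wm)) \<in> jp_permissible \<and>
    (\<exists>Xp Xm. essential_jp_ideal (Xp, Xm) \<and> Xp \<subseteq> Up \<inter> Wp \<and> Xm \<subseteq> Um \<inter> Wm \<and>
      (\<forall>x\<in>Xp. gp x = hp x) \<and> (\<forall>y\<in>Xm. gm y = hm y))}"

definition jp_map_add :: "('a, 'b) jp_map \<Rightarrow> ('a, 'b) jp_map \<Rightarrow> ('a, 'b) jp_map"
  where "jp_map_add = (\<lambda>((gp, gm), U) ((hp, hm), W).
    ((\<lambda>x. gp x + hp x, \<lambda>y. gm y + hm y), jp_star (jp_inter U W) (UNIV, UNIV)))"

definition jp_map_mult :: "('a, 'b) jp_map \<Rightarrow> ('a, 'b) jp_map \<Rightarrow> ('a, 'b) jp_map"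
  where "jp_map_mult = (\<lambda>((gp, gm), U) ((hp, hm), W).
    ((gp \<circ> hp, gm \<circ> hm),
      jp_star (jp_star (jp_inter U W) (UNIV, UNIV)) (UNIV, UNIV)))"

definition jp_extended_centroid :: "('a, 'b) jp_map set ring"
  where "jp_extended_centroid =
    \<lparr>carrier = jp_permissible // jp_map_equiv,
     mult = (\<lambda>A B. \<Union>g\<in>A. \<Union>h\<in>B. jp_map_equiv `` {jp_map_mult g h}),
     one = jp_map_equiv `` {((id, id), (UNIV, UNIV))},
     zero = jp_map_equiv `` {((\<lambda>x. 0, \<lambda>y. 0), (UNIV, UNIV))},
     add = (\<lambda>A B. \<Union>g\<in>A. \<Union>h\<in>B. jp_map_equiv `` {jp_map_add g h})\<rparr>"

end

locale nondegenerate_jordan_pair = jordan_pair +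
  assumes nondegenerate_p: "(\<forall>y. Qp x y = 0) \<Longrightarrow> x = 0"
    and nondegenerate_m: "(\<forall>x. Qm y x = 0) \<Longrightarrow> y = 0"

locale lie_algebra = module scale
  for scale :: "'r::comm_ring_1 \<Rightarrow> 'l::ab_group_add \<Rightarrow> 'l" +
  fixes L :: "'l set"
    and br :: "'l \<Rightarrow> 'l \<Rightarrow> 'l"
  assumes subspace_L: "subspace L"
    and br_closed: "x \<in> L \<Longrightarrow> y \<in> L \<Longrightarrow> br x y \<in> L"
    and br_add_left: "x \<in> L \<Longrightarrow> y \<in> L \<Longrightarrow> z \<in> L \<Longrightarrow> br (x + y) z = br x z + br y z"
    and br_scale_left: "x \<in> L \<Longrightarrow> y \<in> L \<Longrightarrow> br (scale c x) y = scale c (br x y)"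
    and br_add_right: "x \<in> L \<Longrightarrow> y \<in> L \<Longrightarrow> z \<in> L \<Longrightarrow> br x (y + z) = br x y + br x z"
    and br_scale_right: "x \<in> L \<Longrightarrow> y \<in> L \<Longrightarrow> br x (scale c y) = scale c (br x y)"
    and br_self: "x \<in> L \<Longrightarrow> br x x = 0"
    and jacobi: "x \<in> L \<Longrightarrow> y \<in> L \<Longrightarrow> z \<in> L \<Longrightarrow>
      br x (br y z) + br y (br z x) + br z (br x y) = 0"
begin

definition lie_ideal :: "'l set \<Rightarrow> bool"
  where "lie_ideal I \<longleftrightarrow> subspace I \<and> I \<subseteq> L \<and> (\<forall>x\<in>L. \<forall>y\<in>I. br x y \<in> I)"

definition essential_lie_ideal :: "'l set \<Rightarrow> bool"
  where "essential_lie_ideal I \<longleftrightarrow> lie_ideal I \<and>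
    (\<forall>J. lie_ideal J \<and> J \<noteq> {0} \<longrightarrow> I \<inter> J \<noteq> {0})"

definition lie_permissible :: "(('l \<Rightarrow> 'l) \<times> 'l set) set"
  where "lie_permissible = {(f, I). essential_lie_ideal I \<and> f ` I \<subseteq> L \<and>
    (\<forall>x\<in>I. \<forall>y\<in>I. f (x + y) = f x + f y) \<and>
    (\<forall>x\<in>L. \<forall>y\<in>I. f (br x y) = br x (f y))}"

definition lie_map_equiv :: "((('l \<Rightarrow> 'l) \<times> 'l set) \<times> (('l \<Rightarrow> 'l) \<times> 'l set)) set"
  where "lie_map_equiv = {((f, I), (g, J)).
    (f, I) \<in> lie_permissible \<and> (g, J) \<in> lie_permissible \<and>
    (\<exists>X. essential_lie_ideal X \<and> X \<subseteq> I \<inter> J \<and> (\<forall>x\<in>X. f x = g x))}"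

definition lie_map_add ::
  "('l \<Rightarrow> 'l) \<times> 'l set \<Rightarrow> ('l \<Rightarrow> 'l) \<times> 'l set \<Rightarrow> ('l \<Rightarrow> 'l) \<times> 'l set"
  where "lie_map_add = (\<lambda>(f, I) (g, J). (\<lambda>x. f x + g x, I \<inter> J))"

definition lie_map_mult ::
  "('l \<Rightarrow> 'l) \<times> 'l set \<Rightarrow> ('l \<Rightarrow> 'l) \<times> 'l set \<Rightarrow> ('l \<Rightarrow> 'l) \<times> 'l set"
  where "lie_map_mult = (\<lambda>(f, I) (g, J). (f \<circ> g, {x \<in> J. g x \<in> I}))"

text \<open>This is the extended centroid only for semiprime \<open>L\<close>; otherwise the operations below need not
  be independent of the representatives.\<close>

definition lie_extended_centroid :: "(('l \<Rightarrow> 'l) \<times> 'l set) set ring"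
  where "lie_extended_centroid =
    \<lparr>carrier = lie_permissible // lie_map_equiv,
     mult = (\<lambda>A B. \<Union>f\<in>A. \<Union>g\<in>B. lie_map_equiv `` {lie_map_mult f g}),
     one = lie_map_equiv `` {(id, L)},
     zero = lie_map_equiv `` {(\<lambda>x. 0, L)},
     add = (\<lambda>A B. \<Union>f\<in>A. \<Union>g\<in>B. lie_map_equiv `` {lie_map_add f g})\<rparr>"

end

text \<open>An element \<open>(x, (d\<^sup>+, d\<^sup>-), y)\<close> stands for \<open>x \<oplus> (d\<^sup>+, d\<^sup>-) \<oplus> y\<close>. The Lie algebra is the subset
  \<open>tkk_carrier\<close> of this type, in which \<open>(d\<^sup>+, d\<^sup>-)\<close> is an inner derivation.\<close>

type_synonym ('a, 'b) tkk = "'a \<times> (('a \<Rightarrow> 'a) \<times> ('b \<Rightarrow> 'b)) \<times> 'b"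

context jordan_pair
begin

definition der_scale :: "'r \<Rightarrow> ('a \<Rightarrow> 'a) \<times> ('b \<Rightarrow> 'b) \<Rightarrow> ('a \<Rightarrow> 'a) \<times> ('b \<Rightarrow> 'b)"
  where "der_scale c = (\<lambda>(dp, dm). (\<lambda>x. sp c (dp x), \<lambda>y. sm c (dm y)))"

definition der_commutator ::
  "('a \<Rightarrow> 'a) \<times> ('b \<Rightarrow> 'b) \<Rightarrow> ('a \<Rightarrow> 'a) \<times> ('b \<Rightarrow> 'b) \<Rightarrow> ('a \<Rightarrow> 'a) \<times> ('b \<Rightarrow> 'b)"
  where "der_commutator = (\<lambda>(dp, dm) (ep, em). ((dp \<circ> ep) - (ep \<circ> dp), (dm \<circ> em) - (em \<circ> dm)))"

definition inner_der :: "'a \<Rightarrow> 'b \<Rightarrow> ('a \<Rightarrow> 'a) \<times> ('b \<Rightarrow> 'b)"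
  where "inner_der x y = (Tp x y, - Tm y x)"

definition IDer :: "(('a \<Rightarrow> 'a) \<times> ('b \<Rightarrow> 'b)) set"
  where "IDer = module.span der_scale {inner_der x y | x y. True}"

definition tkk_scale :: "'r \<Rightarrow> ('a, 'b) tkk \<Rightarrow> ('a, 'b) tkk"
  where "tkk_scale c = (\<lambda>(x, d, y). (sp c x, der_scale c d, sm c y))"

definition tkk_carrier :: "('a, 'b) tkk set"
  where "tkk_carrier = UNIV \<times> IDer \<times> UNIV"

definition tkk_bracket :: "('a, 'b) tkk \<Rightarrow> ('a, 'b) tkk \<Rightarrow> ('a, 'b) tkk"
  where "tkk_bracket = (\<lambda>(x, d, y) (u, e, v).
    (fst d u - fst e x,
     inner_der x v - inner_der u y + der_commutator d e,
     snd d v - snd e y))"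

sublocale der: module der_scale
  by unfold_locales
    (auto simp: der_scale_def P.scale_right_distrib P.scale_left_distrib
      M.scale_right_distrib M.scale_left_distrib fun_eq_iff prod_eq_iff split_beta)

lemma Qp_add: "Qp x (y + z) = Qp x y + Qp x z" and Qp_scale: "Qp x (sm c y) = sp c (Qp x y)"
  using quadratic_p module_hom.add module_hom.scale unfolding quadratic_product_def by metis+

lemma Qm_add: "Qm x (y + z) = Qm x y + Qm x z" and Qm_scale: "Qm x (sp c y) = sm c (Qm x y)"
  using quadratic_m module_hom.add module_hom.scale unfolding quadratic_product_def by metis+

lemma jp_triple_sym: "jp_triple Q x y z = jp_triple Q z y x"
  for Q :: "'c::ab_group_add \<Rightarrow> 'd \<Rightarrow> 'c"
  by (simp add: jp_triple_def add.commute algebra_simps)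

lemma Tp_add1: "Tp (x + x') y z = Tp x y z + Tp x' y z"
  and Tp_scale1: "Tp (sp c x) y z = sp c (Tp x y z)"
  using quadratic_p unfolding quadratic_product_def by blast+

lemma Tm_add1: "Tm (x + x') y z = Tm x y z + Tm x' y z"
  and Tm_scale1: "Tm (sm c x) y z = sm c (Tm x y z)"
  using quadratic_m unfolding quadratic_product_def by blast+

lemma Tp_add3: "Tp x y (z + z') = Tp x y z + Tp x y z'"
  and Tp_scale3: "Tp x y (sp c z) = sp c (Tp x y z)"
  using Tp_add1 Tp_scale1 jp_triple_sym by metis+

lemma Tm_add3: "Tm x y (z + z') = Tm x y z + Tm x y z'"
  and Tm_scale3: "Tm x y (sm c z) = sm c (Tm x y z)"
  using Tm_add1 Tm_scale1 jp_triple_sym by metis+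

lemma Tp_add2: "Tp x (y + y') z = Tp x y z + Tp x y' z"
  and Tp_scale2: "Tp x (sm c y) z = sp c (Tp x y z)"
  by (simp_all add: jp_triple_def Qp_add Qp_scale P.scale_right_diff_distrib)

lemma Tm_add2: "Tm x (y + y') z = Tm x y z + Tm x y' z"
  and Tm_scale2: "Tm x (sp c y) z = sm c (Tm x y z)"
  by (simp_all add: jp_triple_def Qm_add Qm_scale M.scale_right_diff_distrib)

lemmas T_add = Tp_add1 Tp_add2 Tp_add3 Tm_add1 Tm_add2 Tm_add3
lemmas T_scale = Tp_scale1 Tp_scale2 Tp_scale3 Tm_scale1 Tm_scale2 Tm_scale3

lemma Tp_minus: "Tp (- x) y z = - Tp x y z" "Tp x (- y) z = - Tp x y z" "Tp x y (- z) = - Tp x y z"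
  using Tp_scale1[of "- 1"] Tp_scale2[of _ "- 1"] Tp_scale3[of _ _ "- 1"] by simp_all

lemma Tm_minus: "Tm (- x) y z = - Tm x y z" "Tm x (- y) z = - Tm x y z" "Tm x y (- z) = - Tm x y z"
  using Tm_scale1[of "- 1"] Tm_scale2[of _ "- 1"] Tm_scale3[of _ _ "- 1"] by simp_all

lemma T_diff:
  "Tp (x - x') y z = Tp x y z - Tp x' y z" "Tp x (y - y') z = Tp x y z - Tp x y' z"
  "Tp x y (z - z') = Tp x y z - Tp x y z'" "Tm y (x - x') y' = Tm y x y' - Tm y x' y'"
  "Tm (y - y') x v = Tm y x v - Tm y' x v" "Tm v x (y - y') = Tm v x y - Tm v x y'"
  using Tp_add1[of x "- x'"] Tp_add2[of x y "- y'"] Tp_add3[of x y z "- z'"]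
    Tm_add2[of y x "- x'" y'] Tm_add1[of y "- y'"] Tm_add3[of v x y "- y'"]
  by (simp_all add: Tp_minus Tm_minus)

lemma T_zero: "Tp 0 y z = 0" "Tp x 0 z = 0" "Tp x y 0 = 0" "Tm 0 x y = 0" "Tm y 0 v = 0" "Tm y x 0 = 0"
  using Tp_scale1[of 0] Tp_scale2[of _ 0] Tp_scale3[of _ _ 0]
    Tm_scale1[of 0] Tm_scale2[of _ 0] Tm_scale3[of _ _ 0] by simp_all

end

lemma five_linear_aux:
  fixes Q :: "'a::ab_group_add \<Rightarrow> 'b::ab_group_add \<Rightarrow> 'a" and Q' :: "'b \<Rightarrow> 'a \<Rightarrow> 'b"
  assumes id: "jp_identities Q Q'"
    and add: "\<And>x y z. Q x (y + z) = Q x y + Q x z" "\<And>x y z. Q' x (y + z) = Q' x y + Q' x z"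
    and T3: "\<And>x y z w. jp_triple Q x y (z + w) = jp_triple Q x y z + jp_triple Q x y w"
    and T2: "\<And>x y z w. jp_triple Q x (y + z) w = jp_triple Q x y w + jp_triple Q x z w"
  defines "T \<equiv> jp_triple Q" and "T' \<equiv> jp_triple Q'"
  shows "T x y (T u v w) = T (T x y u) v w - T u (T' y x v) w + T u v (T x y w)"
proof -
  have sym: "T a b c = T c b a" for a b c
    by (simp add: T_def jp_triple_def add.commute algebra_simps)
  have sym': "T' a b c = T' c b a" for a b c
    by (simp add: T'_def jp_triple_def add.commute algebra_simps)
  have 1: "T w y (Q x z) + T x y (T x z w) = T x (T' y x z) w + Q x (T' y w z)" for x y z w
    using id unfolding jp_identities_def Let_def T_def T'_def by blast
  have 2: "T (Q x y) y z = T x (Q' y x) z" for x y z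
    using id unfolding jp_identities_def Let_def T_def T'_def by blast
  have T1: "T (a + b) y z = T a y z + T b y z" for a b y z
    using T3 sym unfolding T_def by metis
  have Q'e: "Q' (y + v) x = Q' y x + Q' v x + T' y x v" for y v x
    by (simp add: T'_def jp_triple_def)
  have Qe: "Q (y + v) x = Q y x + Q v x + T y x v" for y v x
    by (simp add: T_def jp_triple_def)
  have 3: "T (Q x y) v z + T (Q x v) y z = T x (T' y x v) z" for x y v z
    using 2[of x "y + v" z] 2[of x y z] 2[of x v z] T2
    by (simp add: Q'e add T1 T_def[symmetric])
  have 4: "T x y (Q u v) = T (T x y u) v u - Q u (T' y x v)" for x y u v
  proof -
    have "T x v (Q u y) + T u v (T u y x) = T u (T' v u y) x + Q u (T' v x y)"
      by (rule 1)
    then have "T (Q u y) v x + T u v (T u y x) = T (Q u y) v x + T (Q u v) y x + Q u (T' y x v)"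
      unfolding sym'[of v u y] sym'[of v x y] sym[of x v "Q u y"] 3 .
    then have "T (T x y u) v u = T x y (Q u v) + Q u (T' y x v)"
      by (simp add: add.assoc sym[of u v] sym[of u y] sym[of "Q u v"])
    then show ?thesis by simp
  qed
  have "T x y (Q u v) + T x y (Q w v) + T x y (T u v w) = T (T x y u) v u + T (T x y u) v w
      + (T (T x y w) v u + T (T x y w) v w) - (Q u (T' y x v) + Q w (T' y x v) + T u (T' y x v) w)"
    using 4[of x y "u + w" v] by (simp add: Qe T1 T3[folded T_def] ac_simps)
  then show ?thesis
    unfolding 4[of x y u v] 4[of x y w v] sym[of "T x y w" v u]
    by (simp add: algebra_simps)
qed

context jordan_pair
begin

lemma Tp_five: "Tp x y (Tp u v w) = Tp (Tp x y u) v w - Tp u (Tm y x v) w + Tp u v (Tp x y w)"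
  by (rule five_linear_aux[OF identities_p]) (simp_all add: Qp_add Qm_add T_add)

lemma Tm_five: "Tm x y (Tm u v w) = Tm (Tm x y u) v w - Tm u (Tp y x v) w + Tm u v (Tm x y w)"
  by (rule five_linear_aux[OF identities_m]) (simp_all add: Qp_add Qm_add T_add)

lemma T_commutator:
  "Tp x y (Tp u v w) - Tp u v (Tp x y w) = Tp (Tp x y u) v w - Tp u (Tm y x v) w"
  "Tm y x (Tm v u t) - Tm v u (Tm y x t) = Tm (Tm y x v) u t - Tm v (Tp x y u) t"
  using Tp_five[of x y u v w] Tm_five[of y x v u t] by simp_all

lemma inner_der_add: "inner_der (x + u) y = inner_der x y + inner_der u y"
  "inner_der x (y + v) = inner_der x y + inner_der x v"
  by (simp_all add: inner_der_def T_add fun_eq_iff)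

lemma inner_der_diff: "inner_der (x - u) y = inner_der x y - inner_der u y"
  "inner_der x (y - v) = inner_der x y - inner_der x v"
  by (simp_all add: inner_der_def T_diff fun_eq_iff)

lemma inner_der_scale: "inner_der (sp c x) y = der_scale c (inner_der x y)"
  "inner_der x (sm c y) = der_scale c (inner_der x y)"
  by (simp_all add: inner_der_def der_scale_def T_scale fun_eq_iff)

lemma inner_der_IDer: "inner_der x y \<in> IDer"
  unfolding IDer_def by (rule der.span_base) blast

lemma subspace_IDer: "der.subspace IDer"
  unfolding IDer_def by (rule der.subspace_span)

definition lin_der :: "('a \<Rightarrow> 'a) \<times> ('b \<Rightarrow> 'b) \<Rightarrow> bool"
  where "lin_der d \<longleftrightarrow>
    (\<forall>x y. fst d (x + y) = fst d x + fst d y) \<and> (\<forall>c x. fst d (sp c x) = sp c (fst d x)) \<and>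
    (\<forall>x y. snd d (x + y) = snd d x + snd d y) \<and> (\<forall>c x. snd d (sm c x) = sm c (snd d x)) \<and>
    (\<forall>x y. der_commutator d (inner_der x y) = inner_der (fst d x) y + inner_der x (snd d y))"

lemma lin_der_D:
  assumes "lin_der d"
  shows "fst d (x + x') = fst d x + fst d x'" "fst d (sp c x) = sp c (fst d x)"
    "snd d (y + y') = snd d y + snd d y'" "snd d (sm c y) = sm c (snd d y)"
    "fst d (x - x') = fst d x - fst d x'" "snd d (y - y') = snd d y - snd d y'"
    "der_commutator d (inner_der x y) = inner_der (fst d x) y + inner_der x (snd d y)"
proof -
  show 1: "fst d (x + x') = fst d x + fst d x'" "fst d (sp c x) = sp c (fst d x)"
    "snd d (y + y') = snd d y + snd d y'" "snd d (sm c y) = sm c (snd d y)" for x x' c y y'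
    using assms unfolding lin_der_def by blast+
  show "fst d (x - x') = fst d x - fst d x'" "snd d (y - y') = snd d y - snd d y'"
    using 1(1)[of x "- x'"] 1(2)[of "- 1" x'] 1(3)[of y "- y'"] 1(4)[of "- 1" y'] by simp_all
  show "der_commutator d (inner_der x y) = inner_der (fst d x) y + inner_der x (snd d y)"
    using assms unfolding lin_der_def by blast
qed

lemma lin_der_inner: "lin_der (inner_der x y)"
  unfolding lin_der_def inner_der_def der_commutator_def
  by (auto simp: T_add T_scale fun_eq_iff T_commutator Tp_minus Tm_minus)

lemma der_commutator_lin:
  assumes "lin_der d"
  shows "der_commutator d (e + e') = der_commutator d e + der_commutator d e'"
    "der_commutator d (der_scale c e) = der_scale c (der_commutator d e)"
    "der_commutator e d = - der_commutator d e"
  using lin_der_D(1-4)[OF assms]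
  by (simp_all add: der_commutator_def der_scale_def fun_eq_iff prod_eq_iff split_beta
      P.scale_right_diff_distrib M.scale_right_diff_distrib)

lemma lin_der_IDer: "d \<in> IDer \<Longrightarrow> lin_der d"
  unfolding IDer_def
proof (induction rule: der.span_induct_alt)
  case base
  show ?case
    by (auto simp: lin_der_def der_commutator_def inner_der_def zero_prod_def fun_eq_iff T_zero)
next
  case (step c e d)
  then have e: "lin_der e" using lin_der_inner by blast
  have "der_commutator (der_scale c e + d) (inner_der u v) =
      inner_der (fst (der_scale c e + d) u) v + inner_der u (snd (der_scale c e + d) v)" for u v
  proof -
    have "der_commutator (der_scale c e + d) (inner_der u v) =
        - der_commutator (inner_der u v) (der_scale c e + d)"
      by (rule der_commutator_lin(3)[OF lin_der_inner])
    also have "\<dots> = der_scale c (- der_commutator (inner_der u v) e)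
        + - der_commutator (inner_der u v) d"
      by (simp add: der_commutator_lin[OF lin_der_inner] der.scale_minus_right)
    also have "\<dots> = der_scale c (der_commutator e (inner_der u v)) + der_commutator d (inner_der u v)"
      by (simp only: der_commutator_lin(3)[OF lin_der_inner, symmetric])
    also have "\<dots> = der_scale c (inner_der (fst e u) v) + der_scale c (inner_der u (snd e v))
        + (inner_der (fst d u) v + inner_der u (snd d v))"
      by (simp only: lin_der_D(7)[OF e] lin_der_D(7)[OF step(2)] der.scale_right_distrib)
    also have "\<dots> = inner_der (sp c (fst e u) + fst d u) v + inner_der u (sm c (snd e v) + snd d v)"
      by (simp only: inner_der_add inner_der_scale ac_simps)
    finally show ?thesis by (simp add: der_scale_def split_beta)
  qed
  then show ?case
    using lin_der_D(1-4)[OF e] lin_der_D(1-4)[OF step(2)]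
    unfolding lin_der_def
    by (simp add: der_scale_def split_beta P.scale_right_distrib M.scale_right_distrib
        P.scale_left_commute M.scale_left_commute ac_simps)
qed

lemma der_commutator_IDer:
  assumes d: "d \<in> IDer" and e: "e \<in> IDer"
  shows "der_commutator d e \<in> IDer"
  using e[unfolded IDer_def]
proof (induction rule: der.span_induct_alt)
  case base
  have "der_commutator d 0 = 0"
    using der_commutator_lin(1)[OF lin_der_IDer[OF d], of 0 0] by simp
  then show ?case using der.subspace_0[OF subspace_IDer] by simp
next
  case (step c f e)
  then obtain x y where f: "f = inner_der x y" by blast
  show ?case
    using step(2) der_commutator_lin[OF lin_der_IDer[OF d]] lin_der_D(7)[OF lin_der_IDer[OF d]]
      inner_der_IDer subspace_IDer
    by (simp add: f der.subspace_add der.subspace_scale)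
qed

lemma module_tkk: "module tkk_scale"
  by unfold_locales
    (auto simp: tkk_scale_def split_beta prod_eq_iff P.scale_right_distrib P.scale_left_distrib
      M.scale_right_distrib M.scale_left_distrib der.scale_right_distrib der.scale_left_distrib)

lemma der_commutator_add_left: "der_commutator (d + d') e = der_commutator d e + der_commutator d' e"
  if "lin_der e"
  using der_commutator_lin(1)[OF that, of d d'] der_commutator_lin(3)[OF that]
  by simp

lemma der_commutator_scale_left: "der_commutator (der_scale c d) e = der_scale c (der_commutator d e)"
  if "lin_der e"
  using der_commutator_lin(2)[OF that, of c d] der_commutator_lin(3)[OF that]
  by (simp add: der.scale_minus_right)

lemma der_commutator_diff: "der_commutator d (e - e') = der_commutator d e - der_commutator d e'"
  if "lin_der d"
  using der_commutator_lin(1)[OF that, of "e - e'" e'] by simp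

lemma der_commutator_jacobi:
  assumes "lin_der d" "lin_der e" "lin_der f"
  shows "der_commutator d (der_commutator e f) + der_commutator e (der_commutator f d)
    + der_commutator f (der_commutator d e) = 0"
  by (simp add: der_commutator_def fun_eq_iff prod_eq_iff split_beta
      lin_der_D(5,6)[OF assms(1)] lin_der_D(5,6)[OF assms(2)] lin_der_D(5,6)[OF assms(3)])

lemma der_scale_fst_snd:
  "fst (der_scale c d) x = sp c (fst d x)" "snd (der_scale c d) y = sm c (snd d y)"
  by (simp_all add: der_scale_def split_beta)

lemma fst_snd_bracket:
  "fst (inner_der x y) z = Tp x y z" "snd (inner_der x y) w = - Tm y x w"
  "fst (der_commutator d e) z = fst d (fst e z) - fst e (fst d z)"
  "snd (der_commutator d e) w = snd d (snd e w) - snd e (snd d w)"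
  by (simp_all add: inner_der_def der_commutator_def split_beta)

sublocale tkk: lie_algebra tkk_scale tkk_carrier tkk_bracket
proof -
  interpret module tkk_scale by (rule module_tkk)
  note sub = der.subspace_add[OF subspace_IDer] der.subspace_diff[OF subspace_IDer]
    der.subspace_scale[OF subspace_IDer] der.subspace_0[OF subspace_IDer]
  show "lie_algebra tkk_scale tkk_carrier tkk_bracket"
  proof unfold_locales
    show "subspace tkk_carrier"
      using sub by (auto simp: subspace_def tkk_carrier_def tkk_scale_def mem_Times_iff split_beta)
  next
    fix X Y assume "X \<in> tkk_carrier" "Y \<in> tkk_carrier"
    then show "tkk_bracket X Y \<in> tkk_carrier"
      by (auto simp: tkk_carrier_def tkk_bracket_def intro!: sub inner_der_IDer der_commutator_IDer)
  next
    fix X Y Z assume XYZ: "X \<in> tkk_carrier" "Y \<in> tkk_carrier" "Z \<in> tkk_carrier"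
    obtain x d y u e v p f q where eqs: "X = (x, d, y)" "Y = (u, e, v)" "Z = (p, f, q)"
      by (metis prod.exhaust)
    then have ld: "lin_der d" "lin_der e" "lin_der f"
      using XYZ lin_der_IDer by (auto simp: tkk_carrier_def)
    show "tkk_bracket (X + Y) Z = tkk_bracket X Z + tkk_bracket Y Z"
      using lin_der_D[OF ld(3)]
      by (simp add: eqs tkk_bracket_def inner_der_add der_commutator_add_left[OF ld(3)])
    show "tkk_bracket X (Y + Z) = tkk_bracket X Y + tkk_bracket X Z"
      using lin_der_D[OF ld(1)]
      by (simp add: eqs tkk_bracket_def inner_der_add der_commutator_lin(1)[OF ld(1)])
    show "tkk_bracket X (tkk_bracket Y Z) + tkk_bracket Y (tkk_bracket Z X)
        + tkk_bracket Z (tkk_bracket X Y) = 0"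
      unfolding prod_eq_iff[of "tkk_bracket _ _ + _ + _"] prod_eq_iff[of "snd (_ + _ + _)"]
    proof (intro conjI)
      show "fst (snd (tkk_bracket X (tkk_bracket Y Z) + tkk_bracket Y (tkk_bracket Z X)
          + tkk_bracket Z (tkk_bracket X Y))) = fst (snd 0)"
        using der_commutator_jacobi[OF ld]
        by (simp add: eqs tkk_bracket_def inner_der_diff der_commutator_lin(1)[OF ld(1)]
            der_commutator_lin(1)[OF ld(2)] der_commutator_lin(1)[OF ld(3)]
            der_commutator_diff[OF ld(1)] der_commutator_diff[OF ld(2)] der_commutator_diff[OF ld(3)]
            lin_der_D(7)[OF ld(1)] lin_der_D(7)[OF ld(2)] lin_der_D(7)[OF ld(3)])
      show "fst (tkk_bracket X (tkk_bracket Y Z) + tkk_bracket Y (tkk_bracket Z X)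
          + tkk_bracket Z (tkk_bracket X Y)) = fst 0"
        using lin_der_D(5)[OF ld(1)] lin_der_D(5)[OF ld(2)] lin_der_D(5)[OF ld(3)]
          jp_triple_sym[of Qp x q u] jp_triple_sym[of Qp x v p] jp_triple_sym[of Qp u y p]
        by (simp add: eqs tkk_bracket_def fst_snd_bracket)
      show "snd (snd (tkk_bracket X (tkk_bracket Y Z) + tkk_bracket Y (tkk_bracket Z X)
          + tkk_bracket Z (tkk_bracket X Y))) = snd (snd 0)"
        using lin_der_D(6)[OF ld(1)] lin_der_D(6)[OF ld(2)] lin_der_D(6)[OF ld(3)]
          jp_triple_sym[of Qm y p v] jp_triple_sym[of Qm y u q] jp_triple_sym[of Qm v x q]
        by (simp add: eqs tkk_bracket_def fst_snd_bracket)
    qed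
  next
    fix X Y c assume XY: "X \<in> tkk_carrier" "Y \<in> tkk_carrier"
    obtain x d y u e v where eqs: "X = (x, d, y)" "Y = (u, e, v)"
      by (metis prod.exhaust)
    then have ld: "lin_der d" "lin_der e"
      using XY lin_der_IDer by (auto simp: tkk_carrier_def)
    show "tkk_bracket (tkk_scale c X) Y = tkk_scale c (tkk_bracket X Y)"
      using lin_der_D(1-4)[OF ld(2)]
      by (simp add: eqs tkk_bracket_def tkk_scale_def inner_der_scale
          der_commutator_scale_left[OF ld(2)] der.scale_right_diff_distrib der.scale_right_distrib
          P.scale_right_diff_distrib M.scale_right_diff_distrib der_scale_fst_snd)
    show "tkk_bracket X (tkk_scale c Y) = tkk_scale c (tkk_bracket X Y)"
      using lin_der_D(1-4)[OF ld(1)]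
      by (simp add: eqs tkk_bracket_def tkk_scale_def inner_der_scale
          der_commutator_lin(2)[OF ld(1)] der.scale_right_diff_distrib der.scale_right_distrib
          P.scale_right_diff_distrib M.scale_right_diff_distrib der_scale_fst_snd)
  next
    fix X show "tkk_bracket X X = 0"
      by (simp add: tkk_bracket_def der_commutator_def split_beta prod_eq_iff)
  qed
qed

end

end

theory Submission
  imports Defs
begin

text \<open>A permissible map \<open>g\<close> of the Jordan pair extends to the Lie algebra because the degree 0 part
  of the Lie algebra acts faithfully on the pair. Let \<open>U\<close> be the domain of \<open>g\<close>. The Lie ideal
  generated by \<open>U\<close> is \<open>U\<^sup>+ \<oplus> D \<oplus> U\<^sup>-\<close>, where \<open>D\<close> is spanned by the inner derivations with one entry
  in \<open>U\<close>, and every \<open>d\<close> in \<open>D\<close> maps the pair into \<open>U\<close>. So \<open>d \<mapsto> g \<circ> d\<close> is defined on \<open>D\<close> without any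
  choice of a representation of \<open>d\<close> by generators, and the conditions on \<open>g\<close> say that it sends
  \<open>inner_der u y\<close> to \<open>inner_der (g u) y\<close>. This extension, \<open>tkk_map\<close>, is visibly compatible with sums
  and compositions.

  Conversely, a permissible map \<open>f\<close> of the Lie algebra on an ideal \<open>I\<close> preserves degrees, since
  \<open>V\<^sup>+\<close> and \<open>V\<^sup>-\<close> contain their own centralizers (\<open>centralizer_plus\<close>). It therefore restricts to
  \<open>I \<inter> V\<close> (\<open>parts_maps_permissible\<close>), and extending the restriction gives back \<open>f\<close>
  (\<open>tkk_map_surjective\<close>).

  Domains can be exchanged because essential ideals correspond to each other in both directions
  (\<open>essential_closure\<close>, \<open>essential_parts\<close>): a nonzero Lie ideal has nonzero intersection with
  \<open>V\<^sup>+\<close> or \<open>V\<^sup>-\<close> (\<open>parts_zero_imp_zero\<close>). Behind this, behind the centralizers and behind the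
  semiprimeness of the Lie algebra is one consequence of nondegeneracy: \<open>v = 0\<close> as soon as
  \<open>Q\<^sub>x v = 0\<close> for all \<open>x\<close> (\<open>annihilated_eq_0\<close>).

  With \<open>1/2\<close> in the scalars, \<open>Q\<^sub>x y\<close> is half of \<open>{x, y, x}\<close>, and all conditions can be checked on
  triple products. Interchanging \<open>V\<^sup>+\<close> and \<open>V\<^sup>-\<close> gives another such pair (\<open>swapped\<close>), so facts about
  the pair itself are proved on one side and transferred to the other.\<close>

section \<open>Rings of equivalence classes\<close>

lemma quotient_operation:
  assumes r: "equiv P r"
    and cong: "\<And>x x' y y'. (x, x') \<in> r \<Longrightarrow> (y, y') \<in> r \<Longrightarrow> (f x y, f x' y') \<in> r"
    and "x \<in> P" "y \<in> P"
  shows "(\<Union>a\<in>r `` {x}. \<Union>b\<in>r `` {y}. r `` {f a b}) = r `` {f x y}"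
proof (rule UN_equiv_class2[OF r r _ \<open>x \<in> P\<close> \<open>y \<in> P\<close>])
  show "congruent2 r r (\<lambda>a b. r `` {f a b})"
    by (rule congruent2I') (use cong equiv_class_eq[OF r] in blast)
qed

text \<open>A map that reflects and preserves equivalence, and is compatible with two operations up to
  equivalence, pulls congruence of the operation back from its target. This replaces a direct
  comparison of sums and products of equivalent maps of the Jordan pair.\<close>

lemma operation_congruent_transfer:
  assumes s: "equiv P' s"
    and iff: "\<And>x y. x \<in> P \<Longrightarrow> y \<in> P \<Longrightarrow> (x, y) \<in> r \<longleftrightarrow> (\<phi> x, \<phi> y) \<in> s"
    and rP: "r \<subseteq> P \<times> P"
    and closed: "\<And>x y. x \<in> P \<Longrightarrow> y \<in> P \<Longrightarrow> f x y \<in> P"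
    and hom: "\<And>x y. x \<in> P \<Longrightarrow> y \<in> P \<Longrightarrow> (\<phi> (f x y), f' (\<phi> x) (\<phi> y)) \<in> s"
    and cong: "\<And>a a' b b'. (a, a') \<in> s \<Longrightarrow> (b, b') \<in> s \<Longrightarrow> (f' a b, f' a' b') \<in> s"
    and x: "(x, x') \<in> r" and y: "(y, y') \<in> r"
  shows "(f x y, f x' y') \<in> r"
proof -
  have mem: "x \<in> P" "x' \<in> P" "y \<in> P" "y' \<in> P"
    using x y rP by auto
  have "(f' (\<phi> x) (\<phi> y), f' (\<phi> x') (\<phi> y')) \<in> s"
    using x y mem by (intro cong) (simp_all add: iff[symmetric])
  then have "(\<phi> (f x y), \<phi> (f x' y')) \<in> s"
    using hom[OF mem(1,3)] hom[OF mem(2,4)] equivE[OF s] by (metis symD transD)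
  then show ?thesis
    using closed mem by (simp add: iff)
qed

text \<open>Both extended centroids are quotients whose operations are unions over all representatives, so
  a map on representatives induces an isomorphism under the conditions below. That \<open>r\<close> is an
  equivalence relation, and that \<open>m\<close> and \<open>p\<close> respect it, is inherited from \<open>s\<close>.\<close>

lemma quotient_ring_iso:
  fixes R :: "'x set ring" and S :: "'y set ring"
  assumes rP: "r \<subseteq> P \<times> P" and s: "equiv P' s"
    and R: "carrier R = P // r" "\<one>\<^bsub>R\<^esub> = r `` {e}"
      "\<And>A B. A \<otimes>\<^bsub>R\<^esub> B = (\<Union>a\<in>A. \<Union>b\<in>B. r `` {m a b})"
      "\<And>A B. A \<oplus>\<^bsub>R\<^esub> B = (\<Union>a\<in>A. \<Union>b\<in>B. r `` {p a b})"
    and S: "carrier S = P' // s" "\<one>\<^bsub>S\<^esub> = s `` {e'}"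
      "\<And>A B. A \<otimes>\<^bsub>S\<^esub> B = (\<Union>a\<in>A. \<Union>b\<in>B. s `` {m' a b})"
      "\<And>A B. A \<oplus>\<^bsub>S\<^esub> B = (\<Union>a\<in>A. \<Union>b\<in>B. s `` {p' a b})"
    and maps: "\<And>x. x \<in> P \<Longrightarrow> \<phi> x \<in> P'"
    and iff: "\<And>x y. x \<in> P \<Longrightarrow> y \<in> P \<Longrightarrow> (x, y) \<in> r \<longleftrightarrow> (\<phi> x, \<phi> y) \<in> s"
    and surj: "\<And>z. z \<in> P' \<Longrightarrow> \<exists>x\<in>P. (\<phi> x, z) \<in> s"
    and one: "e \<in> P" "(\<phi> e, e') \<in> s"
    and closed: "\<And>x y. x \<in> P \<Longrightarrow> y \<in> P \<Longrightarrow> m x y \<in> P" "\<And>x y. x \<in> P \<Longrightarrow> y \<in> P \<Longrightarrow> p x y \<in> P"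
    and hom: "\<And>x y. x \<in> P \<Longrightarrow> y \<in> P \<Longrightarrow> (\<phi> (m x y), m' (\<phi> x) (\<phi> y)) \<in> s"
      "\<And>x y. x \<in> P \<Longrightarrow> y \<in> P \<Longrightarrow> (\<phi> (p x y), p' (\<phi> x) (\<phi> y)) \<in> s"
    and cong: "\<And>a a' b b'. (a, a') \<in> s \<Longrightarrow> (b, b') \<in> s \<Longrightarrow> (m' a b, m' a' b') \<in> s"
      "\<And>a a' b b'. (a, a') \<in> s \<Longrightarrow> (b, b') \<in> s \<Longrightarrow> (p' a b, p' a' b') \<in> s"
  shows "R \<simeq> S"
proof -
  define h where "h A = s `` (\<phi> ` A)" for A
  have s': "z \<in> P' \<Longrightarrow> (z, z) \<in> s" "sym s" "trans s" for z
    using s by (auto simp: equiv_def refl_on_def)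
  have r_iff: "(x, y) \<in> r \<longleftrightarrow> x \<in> P \<and> y \<in> P \<and> (\<phi> x, \<phi> y) \<in> s" for x y
    using iff rP by auto
  have r: "equiv P r"
  proof (rule equivI[OF rP])
    show "refl_on P r"
      using maps s'(1) by (auto simp: refl_on_def r_iff)
    show "sym r"
      by (rule symI) (simp add: r_iff symD[OF s'(2)])
    show "trans r"
      using transD[OF s'(3)] by (intro transI) (auto simp: r_iff)
  qed
  have h: "h (r `` {x}) = s `` {\<phi> x}" if "x \<in> P" for x
  proof -
    have "s `` {\<phi> y} = s `` {\<phi> x}" if "(x, y) \<in> r" for y
      using that iff[of x y] rP equiv_class_eq[OF s, of "\<phi> x" "\<phi> y"] by auto
    moreover have "(x, x) \<in> r"
      using r that by (auto simp: equiv_def refl_on_def)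
    ultimately show ?thesis
      unfolding h_def by blast
  qed
  have rep: "\<exists>x\<in>P. A = r `` {x}" if "A \<in> P // r" for A
    using that by (auto elim: quotientE)
  have hom_op: "h (\<Union>a\<in>A. \<Union>b\<in>B. r `` {f a b}) = (\<Union>a\<in>h A. \<Union>b\<in>h B. s `` {f' a b})"
    if A: "A \<in> P // r" and B: "B \<in> P // r"
      and closed: "\<And>x y. x \<in> P \<Longrightarrow> y \<in> P \<Longrightarrow> f x y \<in> P"
      and hom: "\<And>x y. x \<in> P \<Longrightarrow> y \<in> P \<Longrightarrow> (\<phi> (f x y), f' (\<phi> x) (\<phi> y)) \<in> s"
      and cong: "\<And>a a' b b'. (a, a') \<in> s \<Longrightarrow> (b, b') \<in> s \<Longrightarrow> (f' a b, f' a' b') \<in> s"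
    for A B f f'
  proof -
    obtain x y where x: "x \<in> P" "A = r `` {x}" and y: "y \<in> P" "B = r `` {y}"
      using rep A B by meson
    have tr: "(f x y, f x' y') \<in> r" if "(x, x') \<in> r" "(y, y') \<in> r" for x x' y y'
      using s iff rP closed hom cong that
      by (rule operation_congruent_transfer[where f = f and f' = f' and \<phi> = \<phi> and P = P])
    have "h (\<Union>a\<in>A. \<Union>b\<in>B. r `` {f a b}) = h (r `` {f x y})"
      unfolding x y
      using quotient_operation[where f = f, OF r tr x(1) y(1)] by simp
    also have "\<dots> = s `` {f' (\<phi> x) (\<phi> y)}"
      using closed hom x y equiv_class_eq[OF s] by (simp add: h)
    also have "\<dots> = (\<Union>a\<in>h A. \<Union>b\<in>h B. s `` {f' a b})"
      unfolding x y h[OF x(1)] h[OF y(1)]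
      using quotient_operation[where f = f', OF s cong maps[OF x(1)] maps[OF y(1)]] by simp
    finally show ?thesis .
  qed
  have mem: "h A \<in> P' // s" if "A \<in> P // r" for A
    using rep[OF that] h maps quotientI[of _ P' s] by auto
  have "h \<in> ring_hom R S"
    unfolding ring_hom_def
    using mem hom_op[where f = m and f' = m', OF _ _ closed(1) hom(1) cong(1)]
      hom_op[where f = p and f' = p', OF _ _ closed(2) hom(2) cong(2)]
      h[OF one(1)] equiv_class_eq[OF s one(2)]
    by (simp add: R S)
  moreover have "bij_betw h (carrier R) (carrier S)"
    unfolding R S
  proof (rule bij_betw_imageI)
    show "inj_on h (P // r)"
    proof (rule inj_onI)
      fix A B assume AB: "A \<in> P // r" "B \<in> P // r" "h A = h B"
      then obtain x y where x: "x \<in> P" "A = r `` {x}" and y: "y \<in> P" "B = r `` {y}"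
        using rep by meson
      then have "(\<phi> x, \<phi> y) \<in> s"
        using AB(3) h maps eq_equiv_class_iff[OF s] by simp
      then show "A = B"
        using x y iff equiv_class_eq[OF r] by simp
    qed
    show "h ` (P // r) = P' // s"
    proof (rule equalityI)
      show "P' // s \<subseteq> h ` (P // r)"
      proof
        fix C assume "C \<in> P' // s"
        then obtain z where z: "z \<in> P'" "C = s `` {z}"
          by (auto elim: quotientE)
        then obtain x where "x \<in> P" "(\<phi> x, z) \<in> s"
          using surj by blast
        then have "h (r `` {x}) = C"
          using z h equiv_class_eq[OF s] by simp
        then show "C \<in> h ` (P // r)"
          using \<open>x \<in> P\<close> quotientI[of x P r] by auto
      qed
    qed (use mem in blast)
  qed
  ultimately show ?thesis
    unfolding is_ring_iso_def ring_iso_def by blast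
qed

section \<open>Permissible maps of a semiprime Lie algebra\<close>

locale semiprime_lie_algebra = lie_algebra +
  assumes abelian_ideal_zero: "lie_ideal Y \<Longrightarrow> (\<And>x y. x \<in> Y \<Longrightarrow> y \<in> Y \<Longrightarrow> br x y = 0) \<Longrightarrow> Y = {0}"
begin

lemma lie_idealD:
  assumes "lie_ideal I"
  shows "subspace I" "0 \<in> I" "x \<in> I \<Longrightarrow> x \<in> L" "x \<in> I \<Longrightarrow> y \<in> I \<Longrightarrow> x + y \<in> I" "x \<in> I \<Longrightarrow> scale c x \<in> I"
    "x \<in> L \<Longrightarrow> y \<in> I \<Longrightarrow> br x y \<in> I"
  using assms subspace_0 subspace_add subspace_scale unfolding lie_ideal_def by blast+

lemma lie_ideal_Int: "lie_ideal I \<Longrightarrow> lie_ideal J \<Longrightarrow> lie_ideal (I \<inter> J)"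
  unfolding lie_ideal_def by (auto intro: subspace_inter)

lemma br_zero: "x \<in> L \<Longrightarrow> br x 0 = 0"
  using br_scale_right[of x x 0] by simp

lemma br_anti:
  assumes "x \<in> L" "y \<in> L"
  shows "br x y = - br y x"
proof -
  have "br x y + br y x = br (x + y) (x + y)"
    using assms subspace_add[OF subspace_L] by (simp only: br_add_left br_add_right) (simp add: br_self)
  also have "\<dots> = 0"
    using assms subspace_add[OF subspace_L] by (simp add: br_self)
  finally show ?thesis
    by (simp add: eq_neg_iff_add_eq_0)
qed

lemma lie_ideal_L: "lie_ideal L"
  unfolding lie_ideal_def by (simp add: subspace_L br_closed)

lemma essential_L: "essential_lie_ideal L"
  unfolding essential_lie_ideal_def by (metis inf.absorb2 lie_ideal_L lie_ideal_def)

lemma essential_imp_ideal: "essential_lie_ideal I \<Longrightarrow> lie_ideal I"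
  unfolding essential_lie_ideal_def by blast

lemma essential_Int: "essential_lie_ideal I \<Longrightarrow> essential_lie_ideal J \<Longrightarrow> essential_lie_ideal (I \<inter> J)"
  unfolding essential_lie_ideal_def by (simp add: lie_ideal_Int Int_assoc)

text \<open>The centre is an abelian ideal.\<close>

lemma centre_zero:
  assumes "z \<in> L" "\<And>x. x \<in> L \<Longrightarrow> br x z = 0"
  shows "z = 0"
proof -
  define Z where "Z = {z \<in> L. \<forall>x\<in>L. br x z = 0}"
  have "lie_ideal Z"
    unfolding lie_ideal_def Z_def
    using subspace_L lie_idealD[OF lie_ideal_L]
    by (auto simp: subspace_def br_zero br_add_right br_scale_right)
  then have "Z = {0}"
    by (rule abelian_ideal_zero) (auto simp: Z_def)
  then show ?thesis
    using assms unfolding Z_def by blast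
qed

lemma permissibleD:
  assumes "(f, I) \<in> lie_permissible"
  shows "essential_lie_ideal I" "lie_ideal I" "x \<in> I \<Longrightarrow> f x \<in> L"
    "x \<in> I \<Longrightarrow> y \<in> I \<Longrightarrow> f (x + y) = f x + f y"
    "x \<in> L \<Longrightarrow> y \<in> I \<Longrightarrow> f (br x y) = br x (f y)"
  using assms essential_imp_ideal unfolding lie_permissible_def by auto

lemma permissible_zero: "(f, I) \<in> lie_permissible \<Longrightarrow> f 0 = 0"
  using permissibleD(4)[of f I 0 0] permissibleD(2) lie_idealD(2) by simp

text \<open>Scalars can be moved through \<open>br x y\<close>, so \<open>f (c y) - c f(y)\<close> is annihilated by every \<open>br x\<close>
  and lies in the centre.\<close>

lemma permissible_scale:
  assumes f: "(f, I) \<in> lie_permissible" and y: "y \<in> I"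
  shows "f (scale c y) = scale c (f y)"
proof -
  note I = lie_idealD[OF permissibleD(2)[OF f]]
  note L = lie_idealD[OF lie_ideal_L]
  have mem: "f (scale c y) \<in> L" "f y \<in> L" "scale c (f y) \<in> L" "y \<in> L"
    using permissibleD(3)[OF f] I L y by auto
  have "br x (f (scale c y) - scale c (f y)) = 0" if x: "x \<in> L" for x
  proof -
    have "br x (f (scale c y)) = br (scale c x) (f y)"
      using permissibleD(5)[OF f] I L x y mem
      by (metis br_scale_left br_scale_right)
    then have "br x (f (scale c y)) = br x (scale c (f y))"
      using x mem by (simp add: br_scale_left br_scale_right)
    moreover have "br x (f (scale c y) - scale c (f y)) + br x (scale c (f y)) = br x (f (scale c y))"
      using x mem subspace_diff[OF subspace_L] by (subst br_add_right[symmetric]) auto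
    ultimately show ?thesis by simp
  qed
  then show ?thesis
    using centre_zero[of "f (scale c y) - scale c (f y)"] mem subspace_diff[OF subspace_L] by simp
qed

lemma permissible_restrict:
  "(f, I) \<in> lie_permissible \<Longrightarrow> essential_lie_ideal J \<Longrightarrow> J \<subseteq> I \<Longrightarrow> (f, J) \<in> lie_permissible"
  unfolding lie_permissible_def by (auto simp: subset_iff image_subset_iff)

text \<open>If \<open>Y\<close> is a nonzero ideal inside \<open>I \<inter> J\<close>, then \<open>br a b \<noteq> 0\<close> for some \<open>a, b\<close> in \<open>Y\<close>, and
  \<open>f (br a b) = br a (f b)\<close> lies in \<open>I\<close> because \<open>a\<close> does.\<close>

lemma essential_vimage:
  assumes f: "(f, J) \<in> lie_permissible" and I: "essential_lie_ideal I"
  shows "essential_lie_ideal {x \<in> J. f x \<in> I}"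
proof -
  note J = lie_idealD[OF permissibleD(2)[OF f]]
  note I' = lie_idealD[OF essential_imp_ideal[OF I]]
  have "lie_ideal {x \<in> J. f x \<in> I}"
    unfolding lie_ideal_def subspace_def
    using J I' permissible_zero[OF f] permissible_scale[OF f] permissibleD(4,5)[OF f] by auto
  moreover have "{x \<in> J. f x \<in> I} \<inter> X \<noteq> {0}" if X: "lie_ideal X" "X \<noteq> {0}" for X
  proof -
    define Y where "Y = I \<inter> (J \<inter> X)"
    have "J \<inter> X \<noteq> {0}" "lie_ideal (J \<inter> X)"
      using X permissibleD(1)[OF f] lie_ideal_Int unfolding essential_lie_ideal_def by auto
    then have Y: "lie_ideal Y" "Y \<noteq> {0}"
      using I lie_ideal_Int unfolding essential_lie_ideal_def Y_def by auto
    then obtain a b where ab: "a \<in> Y" "b \<in> Y" "br a b \<noteq> 0"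
      using abelian_ideal_zero by blast
    have b: "b \<in> L" "b \<in> J" "f b \<in> L" and a: "a \<in> L" "a \<in> I"
      using ab Y_def J permissibleD(3)[OF f] by auto
    have "f (br a b) \<in> I"
      using a b br_anti[of a "f b"] permissibleD(5)[OF f] I'(6) subspace_neg[OF I'(1)] by simp
    then have "br a b \<in> {x \<in> J. f x \<in> I} \<inter> X"
      using lie_idealD(6)[OF Y(1), of a b] lie_idealD(3)[OF Y(1)] ab unfolding Y_def by auto
    then show ?thesis
      using ab(3) by blast
  qed
  ultimately show ?thesis
    unfolding essential_lie_ideal_def by blast
qed

lemma lie_map_equivI:
  "(f, I) \<in> lie_permissible \<Longrightarrow> (g, J) \<in> lie_permissible \<Longrightarrow> essential_lie_ideal X \<Longrightarrow> X \<subseteq> I \<Longrightarrow> X \<subseteq> J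
    \<Longrightarrow> (\<And>x. x \<in> X \<Longrightarrow> f x = g x) \<Longrightarrow> ((f, I), (g, J)) \<in> lie_map_equiv"
  unfolding lie_map_equiv_def by blast

lemma lie_map_equivE:
  assumes "((f, I), (g, J)) \<in> lie_map_equiv"
  obtains X where "(f, I) \<in> lie_permissible" "(g, J) \<in> lie_permissible" "essential_lie_ideal X"
    "X \<subseteq> I" "X \<subseteq> J" "\<And>x. x \<in> X \<Longrightarrow> f x = g x"
  using assms unfolding lie_map_equiv_def by blast

lemma equiv_lie_map_equiv: "equiv lie_permissible lie_map_equiv"
proof (rule equivI)
  show "lie_map_equiv \<subseteq> lie_permissible \<times> lie_permissible"
    unfolding lie_map_equiv_def by auto
  show "refl_on lie_permissible lie_map_equiv"
    by (rule refl_onI) (auto intro: lie_map_equivI permissibleD(1))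
  show "sym lie_map_equiv"
    by (rule symI) (auto elim!: lie_map_equivE intro: lie_map_equivI)
  show "trans lie_map_equiv"
  proof (rule transI, clarify)
    fix f I g J h K
    assume "((f, I), (g, J)) \<in> lie_map_equiv" "((g, J), (h, K)) \<in> lie_map_equiv"
    then show "((f, I), (h, K)) \<in> lie_map_equiv"
    proof (elim lie_map_equivE)
      fix X Y
      assume "(f, I) \<in> lie_permissible" "(h, K) \<in> lie_permissible"
        "essential_lie_ideal X" "essential_lie_ideal Y" "X \<subseteq> I" "X \<subseteq> J" "Y \<subseteq> K"
        "\<And>x. x \<in> X \<Longrightarrow> f x = g x" "\<And>x. x \<in> Y \<Longrightarrow> g x = h x"
      then show ?thesis
        by (intro lie_map_equivI[of _ _ _ _ "X \<inter> Y"] essential_Int) auto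
    qed
  qed
qed

lemma lie_permissible_add:
  assumes f: "(f, I) \<in> lie_permissible" and g: "(g, J) \<in> lie_permissible"
  shows "lie_map_add (f, I) (g, J) \<in> lie_permissible"
  using permissibleD(3,4,5)[OF f] permissibleD(3,4,5)[OF g] lie_idealD(4)[OF lie_ideal_L]
    essential_Int[OF permissibleD(1)[OF f] permissibleD(1)[OF g]]
  unfolding lie_map_add_def lie_permissible_def by (auto simp: br_add_right)

lemma lie_permissible_mult:
  assumes f: "(f, I) \<in> lie_permissible" and g: "(g, J) \<in> lie_permissible"
  shows "lie_map_mult (f, I) (g, J) \<in> lie_permissible"
  using permissibleD(3,4,5)[OF f] permissibleD(3,4,5)[OF g]
    essential_vimage[OF g permissibleD(1)[OF f]]
  unfolding lie_map_mult_def lie_permissible_def by auto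

lemma lie_map_add_congruent:
  assumes "(a, a') \<in> lie_map_equiv" "(b, b') \<in> lie_map_equiv"
  shows "(lie_map_add a b, lie_map_add a' b') \<in> lie_map_equiv"
proof -
  obtain f I f' I' g J g' J' where eqs: "a = (f, I)" "a' = (f', I')" "b = (g, J)" "b' = (g', J')"
    by (metis surj_pair)
  obtain X where X: "(f, I) \<in> lie_permissible" "(f', I') \<in> lie_permissible" "essential_lie_ideal X"
    "X \<subseteq> I" "X \<subseteq> I'" "\<And>x. x \<in> X \<Longrightarrow> f x = f' x"
    using assms(1) lie_map_equivE unfolding eqs by metis
  obtain Y where Y: "(g, J) \<in> lie_permissible" "(g', J') \<in> lie_permissible" "essential_lie_ideal Y"
    "Y \<subseteq> J" "Y \<subseteq> J'" "\<And>x. x \<in> Y \<Longrightarrow> g x = g' x"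
    using assms(2) lie_map_equivE unfolding eqs by metis
  show ?thesis
    using lie_permissible_add[OF X(1) Y(1)] lie_permissible_add[OF X(2) Y(2)] X Y
    unfolding eqs lie_map_add_def prod.case
    by (intro lie_map_equivI[where X = "X \<inter> Y"] essential_Int) auto
qed

lemma lie_map_mult_congruent:
  assumes "(a, a') \<in> lie_map_equiv" "(b, b') \<in> lie_map_equiv"
  shows "(lie_map_mult a b, lie_map_mult a' b') \<in> lie_map_equiv"
proof -
  obtain f I f' I' g J g' J' where eqs: "a = (f, I)" "a' = (f', I')" "b = (g, J)" "b' = (g', J')"
    by (metis surj_pair)
  obtain X where X: "(f, I) \<in> lie_permissible" "(f', I') \<in> lie_permissible" "essential_lie_ideal X"
    "X \<subseteq> I" "X \<subseteq> I'" "\<And>x. x \<in> X \<Longrightarrow> f x = f' x"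
    using assms(1) lie_map_equivE unfolding eqs by metis
  obtain Y where Y: "(g, J) \<in> lie_permissible" "(g', J') \<in> lie_permissible" "essential_lie_ideal Y"
    "Y \<subseteq> J" "Y \<subseteq> J'" "\<And>x. x \<in> Y \<Longrightarrow> g x = g' x"
    using assms(2) lie_map_equivE unfolding eqs by metis
  have "essential_lie_ideal {x \<in> Y. g x \<in> X}"
    using permissible_restrict Y X by (blast intro: essential_vimage)
  then show ?thesis
    using lie_permissible_mult[OF X(1) Y(1)] lie_permissible_mult[OF X(2) Y(2)] X Y
    unfolding eqs lie_map_mult_def prod.case
    by (intro lie_map_equivI[where X = "{x \<in> Y. g x \<in> X}"]) auto
qed

lemma lie_permissible_id: "(id, L) \<in> lie_permissible"
  unfolding lie_permissible_def by (simp add: essential_L)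

end

section \<open>Nondegenerate Jordan pairs with one half\<close>

text \<open>One of the two components of the ideal \<open>U * V\<close>, where \<open>U\<close> and \<open>U'\<close> are the components of the
  ideal of the pair. It takes both products as arguments, so that exchanging the roles of the two
  modules yields the other component.\<close>

definition star_part ::
  "('r::comm_ring_1 \<Rightarrow> 'a::ab_group_add \<Rightarrow> 'a) \<Rightarrow> ('a \<Rightarrow> 'b \<Rightarrow> 'a) \<Rightarrow> ('b \<Rightarrow> 'a \<Rightarrow> 'b) \<Rightarrow> 'a set \<Rightarrow> 'b set \<Rightarrow> 'a set"
  where "star_part s Q Q' U U' =
    module.span s ({Q u y | u y. u \<in> U} \<union> {Q x (Q' u z) | x u z. u \<in> U'})"

locale nondegenerate_jordan_pair_half = nondegenerate_jordan_pair sp sm Qp Qm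
  for sp :: "'r::comm_ring_1 \<Rightarrow> 'a::ab_group_add \<Rightarrow> 'a"
    and sm :: "'r \<Rightarrow> 'b::ab_group_add \<Rightarrow> 'b" and Qp Qm +
  fixes half :: 'r
  assumes half: "2 * half = 1"
begin

lemma swapped: "nondegenerate_jordan_pair_half sm sp Qm Qp half"
  by unfold_locales
    (use quadratic_p quadratic_m identities_p identities_m nondegenerate_p nondegenerate_m half in auto)

lemmas opposite = nondegenerate_jordan_pair_half.axioms(1)[OF swapped, THEN nondegenerate_jordan_pair.axioms(1)]

lemma half_double: "sp half (x + x) = x"
proof -
  have "sp half (x + x) = sp (half + half) x"
    by (simp only: P.scale_left_distrib P.scale_right_distrib)
  then show ?thesis
    using half by (simp only: mult_2) simp
qed

lemma Tp_double: "Tp x y x = Qp x y + Qp x y"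
proof -
  have "sp 2 z = z + z" for z
    using P.scale_left_distrib[of 1 1 z] by simp
  moreover have "Qp (sp 2 x) y = sp (2\<^sup>2) (Qp x y)"
    using quadratic_p unfolding quadratic_product_def by blast
  moreover have "sp (2\<^sup>2) z = sp 2 (sp 2 z)" for z
    by (simp add: power2_eq_square)
  ultimately show ?thesis
    unfolding jp_triple_def by simp
qed

lemma Qp_half: "Qp x y = sp half (Tp x y x)"
  by (simp add: Tp_double half_double)

lemmas Qm_half = nondegenerate_jordan_pair_half.Qp_half[OF swapped]

lemma Tp_Qp: "Tp x y (Qp u v) = Tp (Tp x y u) v u - Qp u (Tm y x v)"
proof -
  have "Tp x y (Qp u v) = sp half (Tp (Tp x y u) v u + Tp (Tp x y u) v u - Tp u (Tm y x v) u)"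
    unfolding Qp_half[of u v] T_scale Tp_five[of x y u v u] jp_triple_sym[of Qp u v "Tp x y u"]
    by (simp add: algebra_simps)
  then show ?thesis
    by (simp only: P.scale_right_diff_distrib half_double Qp_half)
qed

text \<open>The polarization in \<open>x\<close> of the identity \<open>Tp (Qp x y) y z = Tp x (Qm y x) z\<close>.\<close>

lemma Tp_Qm_sum: "Tp x (Qm y u) z + Tp u (Qm y x) z = Tp (Tp x y u) y z"
proof -
  have id: "Tp (Qp x y) y z = Tp x (Qm y x) z" for x
    using identities_p unfolding jp_identities_def Let_def by blast
  have "Qp (x + u) y = Qp x y + Qp u y + Tp x y u"
    by (simp add: jp_triple_def)
  then show ?thesis
    using id[of "x + u"] id[of x] id[of u] by (simp add: T_add Qm_add)
qed

text \<open>If \<open>Qp a v\<close> vanishes for all \<open>a\<close>, then so does \<open>Qp x (Qm v z)\<close>, by the formula for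
  \<open>Tp z v (Qp x v)\<close>. The fundamental formula makes \<open>Qm v x\<close> an absolute zero divisor, so
  \<open>Qm v = 0\<close> and finally \<open>v = 0\<close>.\<close>

lemma annihilated_eq_0:
  assumes "\<And>x. Qp x v = 0"
  shows "v = 0"
proof -
  have T: "Tp x v z = 0" for x z
    using assms by (simp add: jp_triple_def)
  have "Qp x (Tm v z v) = 0" for x z
    using Tp_Qp[of z v x v] by (simp add: T T_zero)
  then have Q: "Qp x (Qm v z) = 0" for x z
    by (simp add: Qm_half Qp_scale)
  have "Qm (Qm v x) z = 0" for x z
  proof -
    have "Qm (Qm v x) z = Qm v (Qp x (Qm v z))"
      using identities_m unfolding jp_identities_def Let_def by blast
    then show ?thesis
      using Q Qm_add[of v 0 0] by simp
  qed
  then show "v = 0"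
    using nondegenerate_m by blast
qed

lemma Tp_annihilated_eq_0: "(\<And>x z. Tp x v z = 0) \<Longrightarrow> v = 0"
  using annihilated_eq_0 by (simp add: Qp_half)

lemmas Tm_annihilated_eq_0 = nondegenerate_jordan_pair_half.Tp_annihilated_eq_0[OF swapped]

subsection \<open>Ideals\<close>

lemma jp_ideal_swap: "jordan_pair.jp_ideal sm sp Qm Qp (Um, Up) \<longleftrightarrow> jp_ideal (Up, Um)"
  unfolding jp_ideal_def jordan_pair.jp_ideal_def[OF opposite] by auto

lemma jp_idealD:
  assumes "jp_ideal (Up, Um)"
  shows "P.subspace Up" "0 \<in> Up" "u \<in> Up \<Longrightarrow> u' \<in> Up \<Longrightarrow> u + u' \<in> Up"
    "u \<in> Up \<Longrightarrow> sp c u \<in> Up" "u \<in> Up \<Longrightarrow> - u \<in> Up" "u \<in> Up \<Longrightarrow> u' \<in> Up \<Longrightarrow> u - u' \<in> Up"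
    "u \<in> Up \<Longrightarrow> Qp u y \<in> Up" "v \<in> Um \<Longrightarrow> Qp x v \<in> Up"
    "u \<in> Up \<Longrightarrow> Tp u y x \<in> Up" "u \<in> Up \<Longrightarrow> Tp x y u \<in> Up" "v \<in> Um \<Longrightarrow> Tp x v z \<in> Up"
proof -
  show sub: "P.subspace Up"
    using assms unfolding jp_ideal_def by blast
  show "u \<in> Up \<Longrightarrow> Tp u y x \<in> Up" "u \<in> Up \<Longrightarrow> Tp x y u \<in> Up"
    using assms jp_triple_sym[of Qp u y x] unfolding jp_ideal_def jp_absorbs_def by auto
  show "u \<in> Up \<Longrightarrow> Qp u y \<in> Up" and Q: "\<And>x. v \<in> Um \<Longrightarrow> Qp x v \<in> Up"
    using assms unfolding jp_ideal_def jp_absorbs_def by blast+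
  show "v \<in> Um \<Longrightarrow> Tp x v z \<in> Up"
    unfolding jp_triple_def by (intro P.subspace_diff[OF sub] Q)
  show "0 \<in> Up" "u \<in> Up \<Longrightarrow> u' \<in> Up \<Longrightarrow> u + u' \<in> Up" "u \<in> Up \<Longrightarrow> sp c u \<in> Up"
    "u \<in> Up \<Longrightarrow> - u \<in> Up" "u \<in> Up \<Longrightarrow> u' \<in> Up \<Longrightarrow> u - u' \<in> Up"
    by (fact P.subspace_0[OF sub] P.subspace_add[OF sub] P.subspace_scale[OF sub]
        P.subspace_neg[OF sub] P.subspace_diff[OF sub])+
qed

lemmas jp_idealD_minus =
  nondegenerate_jordan_pair_half.jp_idealD[OF swapped jp_ideal_swap[THEN iffD2]]

lemma jp_absorbsI:
  assumes "P.subspace Up" "\<And>u y x. u \<in> Up \<Longrightarrow> Tp u y x \<in> Up" "\<And>v x z. v \<in> Um \<Longrightarrow> Tp x v z \<in> Up"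
  shows "jp_absorbs Qp Up Um"
proof -
  have "Qp u y \<in> Up" if "u \<in> Up" for u y
    by (subst Qp_half) (rule P.subspace_scale[OF assms(1) assms(2)[OF that]])
  moreover have "Qp x v \<in> Up" if "v \<in> Um" for x v
    by (subst Qp_half) (rule P.subspace_scale[OF assms(1) assms(3)[OF that]])
  moreover have "Tp x y u \<in> Up" if "u \<in> Up" for u x y
    using assms(2)[OF that] jp_triple_sym[of Qp x y u] by simp
  ultimately show ?thesis
    unfolding jp_absorbs_def by blast
qed

lemmas jp_absorbsI_minus = nondegenerate_jordan_pair_half.jp_absorbsI[OF swapped]

lemma jp_idealI:
  assumes "P.subspace Up" "\<And>u y x. u \<in> Up \<Longrightarrow> Tp u y x \<in> Up" "\<And>v x z. v \<in> Um \<Longrightarrow> Tp x v z \<in> Up"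
    and "M.subspace Um" "\<And>v x y. v \<in> Um \<Longrightarrow> Tm v x y \<in> Um" "\<And>u y w. u \<in> Up \<Longrightarrow> Tm y u w \<in> Um"
  shows "jp_ideal (Up, Um)"
  unfolding jp_ideal_def
  using jp_absorbsI[OF assms(1-3)] jp_absorbsI_minus[OF assms(4-6)] assms(1,4) by simp

lemma jp_ideal_Int: "jp_ideal (Up \<inter> Wp, Um \<inter> Wm)" if "jp_ideal (Up, Um)" "jp_ideal (Wp, Wm)"
  using that by (auto simp: jp_ideal_def jp_absorbs_def intro: P.subspace_inter M.subspace_inter)

lemma jp_ideal_nonzero_iff:
  assumes "jp_ideal (Up, Um)"
  shows "(Up, Um) \<noteq> ({0}, {0}) \<longleftrightarrow> (\<exists>u\<in>Up. u \<noteq> 0) \<or> (\<exists>v\<in>Um. v \<noteq> 0)"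
  using jp_idealD(2)[OF assms] jp_idealD_minus(2)[OF assms] by auto

lemma jp_ideal_UNIV: "jp_ideal (UNIV, UNIV)"
  by (simp add: jp_ideal_def jp_absorbs_def P.subspace_UNIV M.subspace_UNIV)

lemma essential_jp_idealD: "essential_jp_ideal U \<Longrightarrow> jp_ideal U"
  unfolding essential_jp_ideal_def by blast

lemma essential_jp_ideal_iff:
  "essential_jp_ideal (Up, Um) \<longleftrightarrow> jp_ideal (Up, Um) \<and>
    (\<forall>Wp Wm. jp_ideal (Wp, Wm) \<longrightarrow> (Wp, Wm) \<noteq> ({0}, {0}) \<longrightarrow> (Up \<inter> Wp, Um \<inter> Wm) \<noteq> ({0}, {0}))"
  unfolding essential_jp_ideal_def split_paired_All jp_inter_def prod.case by blast

lemma essential_jp_ideal_swap: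
  "jordan_pair.essential_jp_ideal sm sp Qm Qp (Um, Up) \<longleftrightarrow> essential_jp_ideal (Up, Um)"
  unfolding essential_jp_ideal_iff nondegenerate_jordan_pair_half.essential_jp_ideal_iff[OF swapped]
    jp_ideal_swap prod.inject by blast

lemma essential_jp_idealI:
  assumes "jp_ideal (Up, Um)"
    and "\<And>Wp Wm. jp_ideal (Wp, Wm) \<Longrightarrow> (Wp, Wm) \<noteq> ({0}, {0}) \<Longrightarrow> (Up \<inter> Wp, Um \<inter> Wm) \<noteq> ({0}, {0})"
  shows "essential_jp_ideal (Up, Um)"
  using assms unfolding essential_jp_ideal_iff by blast

lemma essential_jp_ideal_meets:
  assumes "essential_jp_ideal (Up, Um)" "jp_ideal (Wp, Wm)" "(Wp, Wm) \<noteq> ({0}, {0})"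
  shows "(Up \<inter> Wp, Um \<inter> Wm) \<noteq> ({0}, {0})"
  using assms unfolding essential_jp_ideal_iff by blast

lemma essential_jp_ideal_Int:
  assumes "essential_jp_ideal (Up, Um)" "essential_jp_ideal (Wp, Wm)"
  shows "essential_jp_ideal (Up \<inter> Wp, Um \<inter> Wm)"
proof (rule essential_jp_idealI)
  show "jp_ideal (Up \<inter> Wp, Um \<inter> Wm)"
    using assms by (intro jp_ideal_Int essential_jp_idealD)
next
  fix Xp Xm assume X: "jp_ideal (Xp, Xm)" "(Xp, Xm) \<noteq> ({0}, {0})"
  show "(Up \<inter> Wp \<inter> Xp, Um \<inter> Wm \<inter> Xm) \<noteq> ({0}, {0})"
    using essential_jp_ideal_meets[OF assms(1) jp_ideal_Int[OF essential_jp_idealD[OF assms(2)] X(1)]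
        essential_jp_ideal_meets[OF assms(2) X]]
    by (simp only: Int_assoc not_False_eq_True)
qed

lemma essential_jp_ideal_UNIV: "essential_jp_ideal (UNIV, UNIV)"
  by (rule essential_jp_idealI) (simp_all add: jp_ideal_UNIV)

lemma jp_star_UNIV: "jp_star (Up, Um) (UNIV, UNIV) = (star_part sp Qp Qm Up Um, star_part sm Qm Qp Um Up)"
  unfolding jp_star_def star_part_def by simp

lemma star_part_subset:
  assumes "jp_ideal (Up, Um)"
  shows "star_part sp Qp Qm Up Um \<subseteq> Up"
  unfolding star_part_def
  by (rule P.span_minimal) (use jp_idealD[OF assms] jp_idealD_minus[OF assms] in auto)

lemmas star_part_subset_minus =
  nondegenerate_jordan_pair_half.star_part_subset[OF swapped jp_ideal_swap[THEN iffD2]]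

lemma Qp_star_part: "u \<in> Up \<Longrightarrow> Qp u y \<in> star_part sp Qp Qm Up Um"
    "v \<in> Um \<Longrightarrow> Qp x (Qm v z) \<in> star_part sp Qp Qm Up Um"
  unfolding star_part_def by (rule P.span_base; blast)+

lemma star_part_diff:
  "k \<in> star_part sp Qp Qm Up Um \<Longrightarrow> k' \<in> star_part sp Qp Qm Up Um \<Longrightarrow> k - k' \<in> star_part sp Qp Qm Up Um"
  unfolding star_part_def by (rule P.span_diff)

lemma star_part_add_scale:
  "k \<in> star_part sp Qp Qm Up Um \<Longrightarrow> k' \<in> star_part sp Qp Qm Up Um \<Longrightarrow> sp c k + k' \<in> star_part sp Qp Qm Up Um"
  unfolding star_part_def by (intro P.span_add P.span_scale)

lemma star_part_induct [consumes 1, case_names zero Q QQ]: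
  assumes "k \<in> star_part sp Qp Qm Up Um" and "R 0"
    and "\<And>u y c k. u \<in> Up \<Longrightarrow> k \<in> star_part sp Qp Qm Up Um \<Longrightarrow> R k \<Longrightarrow> R (sp c (Qp u y) + k)"
    and "\<And>x v z c k. v \<in> Um \<Longrightarrow> k \<in> star_part sp Qp Qm Up Um \<Longrightarrow> R k \<Longrightarrow> R (sp c (Qp x (Qm v z)) + k)"
  shows "R k"
proof -
  have "k \<in> star_part sp Qp Qm Up Um \<and> R k"
    using assms(1) unfolding star_part_def[of sp Qp Qm Up Um]
  proof (induction rule: P.span_induct_alt)
    case base
    then show ?case using assms(2) by (simp add: P.span_zero)
  next
    case (step c k k')
    then show ?case
      unfolding star_part_def[symmetric]
      using assms(3,4) by (auto intro!: star_part_add_scale Qp_star_part)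
  qed
  then show ?thesis ..
qed

lemma star_part_Tp:
  assumes "u \<in> Up" "u' \<in> Up" "jp_ideal (Up, Um)"
  shows "Tp u y u' \<in> star_part sp Qp Qm Up Um"
  unfolding jp_triple_def using assms jp_idealD(3)[OF assms(3)]
  by (intro star_part_diff Qp_star_part) auto

text \<open>\<open>Tp_Qp\<close> moves \<open>Tp x y\<close> inside \<open>Qp u w\<close>. For a generator \<open>Qp a (Qm v z)\<close> the identity is used
  twice, once for \<open>Tp x y\<close> and once for the operator \<open>Tm y x\<close> that then acts on \<open>Qm v z\<close>.\<close>

lemma Tp_star_part:
  assumes U: "jp_ideal (Up, Um)" and k: "k \<in> star_part sp Qp Qm Up Um"
  shows "Tp x y k \<in> star_part sp Qp Qm Up Um"
  using k
proof (induction rule: star_part_induct)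
  case zero
  show ?case by (simp add: T_zero star_part_def P.span_zero)
next
  case (Q u w c k)
  have "Tp x y (Qp u w) \<in> star_part sp Qp Qm Up Um"
    unfolding Tp_Qp using Q(1) U jp_idealD[OF U]
    by (intro star_part_diff star_part_Tp Qp_star_part) auto
  then show ?case
    using Q by (simp add: T_add T_scale star_part_add_scale)
next
  case (QQ a v z c k)
  have tri: "Tp b (Qm v w) b' \<in> star_part sp Qp Qm Up Um" if "v \<in> Um" for b b' v w
    unfolding jp_triple_def using that by (intro star_part_diff Qp_star_part) auto
  have "Qp a (Tm y x (Qm v z)) \<in> star_part sp Qp Qm Up Um"
  proof -
    have diff: "Qp a (w - w') = Qp a w - Qp a w'" for w w'
      using Qp_add[of a "w - w'" w'] by (simp add: algebra_simps)
    have "Tm y x (Qm v z) = Qm (Tm y x v + v) z - Qm (Tm y x v) z - Qm v z - Qm v (Tp x y z)"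
      unfolding nondegenerate_jordan_pair_half.Tp_Qp[OF swapped] by (simp add: jp_triple_def[of Qm "Tm y x v"])
    then show ?thesis
      using QQ(1) jp_idealD_minus[OF U] by (auto simp: diff intro!: star_part_diff Qp_star_part(2))
  qed
  then have "Tp x y (Qp a (Qm v z)) \<in> star_part sp Qp Qm Up Um"
    unfolding Tp_Qp using QQ(1) by (intro star_part_diff tri)
  then show ?case
    using QQ by (simp add: T_add T_scale star_part_add_scale)
qed

text \<open>The difficult generators are \<open>Qm y (Qp u w)\<close> with \<open>u\<close> in \<open>Up\<close>. The polarized fundamental
  formula expresses \<open>Qp x (Qm y (Qp u w))\<close> by elements of the ideal and by a term
  \<open>Tp x (Qm y u') u\<close>, which \<open>Tp_Qm_sum\<close> turns into triple products with two outer entries in \<open>Up\<close>.\<close>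

lemma Qp_star_part_minus:
  assumes U: "jp_ideal (Up, Um)" and k: "k \<in> star_part sm Qm Qp Um Up"
  shows "Qp x k \<in> star_part sp Qp Qm Up Um"
proof -
  have T: "Tp a y k \<in> star_part sp Qp Qm Up Um" "Tp k y a \<in> star_part sp Qp Qm Up Um"
    if "k \<in> star_part sp Qp Qm Up Um" for a y k
    using Tp_star_part[OF U that, of a y] jp_triple_sym[of Qp k y a] by auto
  have QQQ: "Qp x (Qm y (Qp u w)) \<in> star_part sp Qp Qm Up Um" if u: "u \<in> Up" for y u w
  proof -
    have "Qp (Tp x y u) w + Tp (Qp x y) w (Qp u y) =
        Qp x (Qm y (Qp u w)) + Qp u (Qm y (Qp x w)) + Tp x (Qm y (Tp x w u)) u"
      using identities_p unfolding jp_identities_def Let_def by blast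
    then have "Qp x (Qm y (Qp u w)) = Qp (Tp x y u) w - Qp u (Qm y (Qp x w))
        - (Tp x (Qm y (Tp x w u)) u - Tp (Qp x y) w (Qp u y))"
      by (simp add: algebra_simps)
    moreover have "Tp x (Qm y u') u \<in> star_part sp Qp Qm Up Um" if "u' \<in> Up" for u'
    proof -
      have "Tp x (Qm y u') u = Tp (Tp x y u') y u - Tp u' (Qm y x) u"
        using Tp_Qm_sum[of x y u' u] by (simp add: algebra_simps)
      then show ?thesis
        using u that jp_idealD(10)[OF U] by (simp add: star_part_diff star_part_Tp[OF _ _ U])
    qed
    ultimately show ?thesis
      using u jp_idealD(10)[OF U] Qp_star_part(1) T(1) by (simp add: star_part_diff)
  qed
  show ?thesis
    using k
  proof (induction rule: nondegenerate_jordan_pair_half.star_part_induct[OF swapped, consumes 1, case_names zero Q QQ])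
    case zero
    show ?case
      using Qp_scale[of x 0 0] by (simp add: star_part_def P.span_zero)
  qed (simp_all add: Qp_add Qp_scale star_part_add_scale QQQ Qp_star_part(2))
qed

lemma jp_absorbs_star_part:
  assumes U: "jp_ideal (Up, Um)"
  shows "jp_absorbs Qp (star_part sp Qp Qm Up Um) (star_part sm Qm Qp Um Up)"
  unfolding jp_absorbs_def
  by (intro conjI ballI allI Tp_star_part[OF U] Qp_star_part_minus[OF U] Qp_star_part(1)
      subsetD[OF star_part_subset[OF U]])

lemmas jp_absorbs_star_part_minus =
  nondegenerate_jordan_pair_half.jp_absorbs_star_part[OF swapped jp_ideal_swap[THEN iffD2]]

lemma jp_ideal_star:
  assumes U: "jp_ideal (Up, Um)"
  shows "jp_ideal (star_part sp Qp Qm Up Um, star_part sm Qm Qp Um Up)"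
  using jp_absorbs_star_part[OF U] jp_absorbs_star_part_minus[OF U]
  unfolding jp_ideal_def by (simp add: star_part_def P.subspace_span M.subspace_span)

text \<open>If \<open>u\<close> is a nonzero element of both ideals, then so is some \<open>Qp u y\<close>, by nondegeneracy, and it
  lies in \<open>U * V\<close>.\<close>

lemma star_part_meets:
  assumes "jp_ideal (Wp, Wm)" "u \<in> Up \<inter> Wp" "u \<noteq> 0"
  shows "\<exists>k \<in> star_part sp Qp Qm Up Um \<inter> Wp. k \<noteq> 0"
proof -
  obtain y where "Qp u y \<noteq> 0"
    using nondegenerate_p assms(3) by blast
  moreover have "Qp u y \<in> star_part sp Qp Qm Up Um" "Qp u y \<in> Wp"
    using assms(2) jp_idealD(7)[OF assms(1)] by (auto intro: Qp_star_part)
  ultimately show ?thesis by blast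
qed

lemmas star_part_meets_minus =
  nondegenerate_jordan_pair_half.star_part_meets[OF swapped jp_ideal_swap[THEN iffD2]]

lemma essential_star:
  assumes "essential_jp_ideal (Up, Um)"
  shows "essential_jp_ideal (star_part sp Qp Qm Up Um, star_part sm Qm Qp Um Up)"
proof (rule essential_jp_idealI)
  show "jp_ideal (star_part sp Qp Qm Up Um, star_part sm Qm Qp Um Up)"
    by (rule jp_ideal_star[OF essential_jp_idealD[OF assms]])
next
  fix Wp Wm assume W: "jp_ideal (Wp, Wm)" "(Wp, Wm) \<noteq> ({0}, {0})"
  have "(\<exists>u\<in>Up \<inter> Wp. u \<noteq> 0) \<or> (\<exists>v\<in>Um \<inter> Wm. v \<noteq> 0)"
    by (rule jp_ideal_nonzero_iff[THEN iffD1])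
      (rule jp_ideal_Int[OF essential_jp_idealD[OF assms] W(1)] essential_jp_ideal_meets[OF assms W])+
  then have "(\<exists>u\<in>star_part sp Qp Qm Up Um \<inter> Wp. u \<noteq> 0) \<or> (\<exists>v\<in>star_part sm Qm Qp Um Up \<inter> Wm. v \<noteq> 0)"
    using star_part_meets[OF W(1)] star_part_meets_minus[OF W(1)] by meson
  then show "(star_part sp Qp Qm Up Um \<inter> Wp, star_part sm Qm Qp Um Up \<inter> Wm) \<noteq> ({0}, {0})"
    by (metis Pair_inject singletonD)
qed

end

section \<open>Permissible maps of a Jordan pair\<close>

context nondegenerate_jordan_pair_half
begin

text \<open>Since \<open>Qp x y\<close> is half of \<open>Tp x y x\<close>, the condition on squares of \<open>g\<close> follows from the
  linearized conditions.\<close>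

lemma jp_hom_conditionsI:
  assumes "P.subspace Up" "jp_absorbs Qp Up Um" "linear_on_submodule sp Up gp"
    and T: "\<And>u y x. u \<in> Up \<Longrightarrow> gp (Tp u y x) = Tp (gp u) y x"
      "\<And>v x z. v \<in> Um \<Longrightarrow> gp (Tp x v z) = Tp x (gm v) z"
  shows "jp_hom_conditions Qp Up Um gp gm"
proof -
  have scale: "gp (sp c u) = sp c (gp u)" if "u \<in> Up" for c u
    using assms(3) that unfolding linear_on_submodule_def by blast
  have absorb: "Tp x y u \<in> Up" "Qp u y \<in> Up" if "u \<in> Up" for x y u
    using assms(2) that unfolding jp_absorbs_def by blast+
  have absorb': "Tp x v x \<in> Up" if "v \<in> Um" for x v
    using assms(2) that Tp_double P.subspace_add[OF assms(1)] unfolding jp_absorbs_def by simp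
  have T': "gp (Tp x y u) = Tp x y (gp u)" if "u \<in> Up" for x y u
    using T(1)[OF that, of y x] by (simp add: jp_triple_sym[of Qp x])
  have Q: "gp (Qp u y) = sp half (Tp (gp u) y u)" if "u \<in> Up" for u y
    using that by (subst Qp_half) (simp add: scale absorb T)
  show ?thesis
    unfolding jp_hom_conditions_def
  proof (intro conjI allI ballI)
    fix x v assume v: "v \<in> Um"
    show "gp (Qp x v) = Qp x (gm v)"
      using v by (simp only: Qp_half scale absorb' T(2))
  next
    fix u y assume u: "u \<in> Up"
    show "gp (Qp u y) \<in> Up"
      using u by (simp add: Q P.subspace_scale[OF assms(1)] absorb)
    show "gp (gp (Qp u y)) = Qp (gp u) y"
      using u by (simp only: Q scale absorb T') (simp only: Qp_half)
  qed (simp add: T)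
qed

lemmas jp_hom_conditionsI_minus = nondegenerate_jordan_pair_half.jp_hom_conditionsI[OF swapped]

lemma jp_permissibleI:
  assumes U: "essential_jp_ideal (Up, Um)"
    and "\<And>x y. x \<in> Up \<Longrightarrow> y \<in> Up \<Longrightarrow> gp (x + y) = gp x + gp y"
      "\<And>c x. x \<in> Up \<Longrightarrow> gp (sp c x) = sp c (gp x)"
      "\<And>u y x. u \<in> Up \<Longrightarrow> gp (Tp u y x) = Tp (gp u) y x"
      "\<And>v x z. v \<in> Um \<Longrightarrow> gp (Tp x v z) = Tp x (gm v) z"
    and "\<And>x y. x \<in> Um \<Longrightarrow> y \<in> Um \<Longrightarrow> gm (x + y) = gm x + gm y"
      "\<And>c x. x \<in> Um \<Longrightarrow> gm (sm c x) = sm c (gm x)"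
      "\<And>v x y. v \<in> Um \<Longrightarrow> gm (Tm v x y) = Tm (gm v) x y"
      "\<And>u y w. u \<in> Up \<Longrightarrow> gm (Tm y u w) = Tm y (gp u) w"
  shows "((gp, gm), (Up, Um)) \<in> jp_permissible"
proof -
  have lin: "linear_on_submodule sp Up gp" "linear_on_submodule sm Um gm"
    unfolding linear_on_submodule_def using assms(2,3,6,7) by simp_all
  have U': "P.subspace Up" "M.subspace Um" "jp_absorbs Qp Up Um" "jp_absorbs Qm Um Up"
    using essential_jp_idealD[OF U] unfolding jp_ideal_def by simp_all
  show ?thesis
    unfolding jp_permissible_def mem_Collect_eq prod.case
    by (intro conjI U lin jp_hom_conditionsI jp_hom_conditionsI_minus U' assms)
qed

lemma jp_permissible_swap:
  "((gm, gp), (Um, Up)) \<in> jordan_pair.jp_permissible sm sp Qm Qp \<longleftrightarrow> ((gp, gm), (Up, Um)) \<in> jp_permissible"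
  unfolding jp_permissible_def jordan_pair.jp_permissible_def[OF opposite] mem_Collect_eq prod.case
    essential_jp_ideal_swap by (simp only: conj_ac)

lemma jp_permissibleD:
  assumes g: "((gp, gm), (Up, Um)) \<in> jp_permissible"
  shows "essential_jp_ideal (Up, Um)" "jp_ideal (Up, Um)"
    "x \<in> Up \<Longrightarrow> y \<in> Up \<Longrightarrow> gp (x + y) = gp x + gp y" "x \<in> Up \<Longrightarrow> gp (sp c x) = sp c (gp x)"
    "gp 0 = 0" "x \<in> Up \<Longrightarrow> gp (- x) = - gp x" "x \<in> Up \<Longrightarrow> y \<in> Up \<Longrightarrow> gp (x - y) = gp x - gp y"
    "x \<in> Up \<Longrightarrow> gp (Tp x b a) = Tp (gp x) b a" "x \<in> Up \<Longrightarrow> gp (Tp a b x) = Tp a b (gp x)"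
    "v \<in> Um \<Longrightarrow> gp (Tp a v c') = Tp a (gm v) c'"
proof -
  show "essential_jp_ideal (Up, Um)"
    using g unfolding jp_permissible_def by simp
  then show U: "jp_ideal (Up, Um)"
    by (rule essential_jp_idealD)
  have cond: "linear_on_submodule sp Up gp" "jp_hom_conditions Qp Up Um gp gm"
    using g unfolding jp_permissible_def by simp_all
  then show add: "x \<in> Up \<Longrightarrow> y \<in> Up \<Longrightarrow> gp (x + y) = gp x + gp y"
      and scale: "x \<in> Up \<Longrightarrow> gp (sp c x) = sp c (gp x)" for x y c
    unfolding linear_on_submodule_def by blast+
  show "gp 0 = 0"
    using scale[of 0 0] jp_idealD(2)[OF U] by simp
  show minus: "x \<in> Up \<Longrightarrow> gp (- x) = - gp x" for x
    using scale[of x "- 1"] by simp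
  show diff: "x \<in> Up \<Longrightarrow> y \<in> Up \<Longrightarrow> gp (x - y) = gp x - gp y" for x y
    using add[of x "- y"] minus[of y] jp_idealD(5)[OF U] by simp
  show T: "x \<in> Up \<Longrightarrow> gp (Tp x b a) = Tp (gp x) b a"
    using cond(2) unfolding jp_hom_conditions_def by blast
  then show "x \<in> Up \<Longrightarrow> gp (Tp a b x) = Tp a b (gp x)"
    using jp_triple_sym[of Qp a b x] jp_triple_sym[of Qp a b "gp x"] by simp
  have Q: "v \<in> Um \<Longrightarrow> gp (Qp x v) = Qp x (gm v)" for x
    using cond(2) unfolding jp_hom_conditions_def by blast
  show "v \<in> Um \<Longrightarrow> gp (Tp a v c') = Tp a (gm v) c'"
    using jp_idealD(6,8)[OF U] unfolding jp_triple_def by (simp add: diff Q)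
qed

lemmas jp_permissibleD_minus =
  nondegenerate_jordan_pair_half.jp_permissibleD[OF swapped jp_permissible_swap[THEN iffD2]]

text \<open>A permissible map sends \<open>Qp u y\<close> to \<open>sp half (Tp (gp u) y u)\<close>, which lies in every ideal
  containing \<open>u\<close>. This is what makes sums and compositions permissible on the smaller domains.\<close>

lemma jp_permissible_Qp:
  assumes g: "((gp, gm), (Up, Um)) \<in> jp_permissible" and N: "jp_ideal (Np, Nm)" "Np \<subseteq> Up"
    and u: "u \<in> Np"
  shows "gp (Qp u y) \<in> Np"
proof -
  have "u \<in> Up"
    using u N(2) by blast
  then have "gp (Qp u y) = sp half (Tp (gp u) y u)"
    using jp_permissibleD(4,8)[OF g] jp_idealD(9)[OF jp_permissibleD(2)[OF g]]
    by (subst Qp_half) simp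
  then show ?thesis
    using u jp_idealD(4,10)[OF N(1)] by simp
qed

lemmas jp_permissible_Qm = nondegenerate_jordan_pair_half.jp_permissible_Qp
  [OF swapped jp_permissible_swap[THEN iffD2] jp_ideal_swap[THEN iffD2]]

text \<open>The point of the domains \<open>N * V\<close> is that \<open>g\<close> maps them back into \<open>N\<close>, so that permissible
  maps can be composed.\<close>

lemma jp_permissible_star_part:
  assumes g: "((gp, gm), (Up, Um)) \<in> jp_permissible" and N: "jp_ideal (Np, Nm)" "Np \<subseteq> Up" "Nm \<subseteq> Um"
    and k: "k \<in> star_part sp Qp Qm Np Nm"
  shows "gp k \<in> Np"
  using k
proof (induction rule: star_part_induct)
  case zero
  show ?case
    using jp_permissibleD(5)[OF g] jp_idealD(2)[OF N(1)] by simp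
next
  case (Q u y c k)
  have "Qp u y \<in> Up" "k \<in> Up"
    using Q(1,2) N(2) jp_idealD(7)[OF N(1)] star_part_subset[OF N(1)] by blast+
  then have "gp (sp c (Qp u y) + k) = sp c (gp (Qp u y)) + gp k"
    using jp_permissibleD(3,4)[OF g] jp_idealD(4)[OF jp_permissibleD(2)[OF g]] by simp
  then show ?case
    using Q jp_idealD(3,4)[OF N(1)] jp_permissible_Qp[OF g N(1,2)] by simp
next
  case (QQ x v z c k)
  have v: "Qm v z \<in> Nm" "gm (Qm v z) \<in> Nm" "Qm v z \<in> Um"
    using QQ(1) N(3) jp_idealD_minus(7)[OF N(1)] jp_permissible_Qm[OF g N(1,3)] by blast+
  have "Qp x (Qm v z) \<in> Up" "k \<in> Up"
    using QQ(2) v(1) N(2) jp_idealD(8)[OF N(1)] star_part_subset[OF N(1)] by blast+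
  then have "gp (sp c (Qp x (Qm v z)) + k) = sp c (gp (Qp x (Qm v z))) + gp k"
    using jp_permissibleD(3,4)[OF g] jp_idealD(4)[OF jp_permissibleD(2)[OF g]] by simp
  moreover have "gp (Qp x (Qm v z)) = Qp x (gm (Qm v z))"
    using jp_permissibleD(4,10)[OF g] v jp_idealD(11)[OF jp_permissibleD(2)[OF g]]
    by (simp only: Qp_half[of x])
  ultimately show ?case
    using QQ(3) v jp_idealD(3,4,8)[OF N(1)] by simp
qed

lemmas jp_permissible_star_part_minus = nondegenerate_jordan_pair_half.jp_permissible_star_part
  [OF swapped jp_permissible_swap[THEN iffD2] jp_ideal_swap[THEN iffD2]]

lemma jp_map_add_permissible:
  assumes g: "((gp, gm), (Up, Um)) \<in> jp_permissible" and h: "((hp, hm), (Wp, Wm)) \<in> jp_permissible"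
  shows "jp_map_add ((gp, gm), (Up, Um)) ((hp, hm), (Wp, Wm)) \<in> jp_permissible"
proof -
  have N: "jp_ideal (Up \<inter> Wp, Um \<inter> Wm)"
    using jp_ideal_Int jp_permissibleD(2) g h by blast
  note sub = subsetD[OF star_part_subset[OF N]] subsetD[OF star_part_subset_minus[OF N]]
  have sub': "x \<in> star_part sp Qp Qm (Up \<inter> Wp) (Um \<inter> Wm) \<Longrightarrow> x \<in> Up \<and> x \<in> Wp"
    "y \<in> star_part sm Qm Qp (Um \<inter> Wm) (Up \<inter> Wp) \<Longrightarrow> y \<in> Um \<and> y \<in> Wm" for x y
    using sub by blast+
  note D = jp_permissibleD[OF g] jp_permissibleD[OF h] jp_permissibleD_minus[OF g] jp_permissibleD_minus[OF h]
  show ?thesis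
    unfolding jp_map_add_def prod.case jp_inter_def jp_star_UNIV
  proof (rule jp_permissibleI)
    show "essential_jp_ideal (star_part sp Qp Qm (Up \<inter> Wp) (Um \<inter> Wm), star_part sm Qm Qp (Um \<inter> Wm) (Up \<inter> Wp))"
      by (rule essential_star[OF essential_jp_ideal_Int[OF jp_permissibleD(1)[OF g] jp_permissibleD(1)[OF h]]])
  qed (auto dest!: sub' simp: D T_add P.scale_right_distrib M.scale_right_distrib)
qed

lemma jp_map_mult_permissible:
  assumes g: "((gp, gm), (Up, Um)) \<in> jp_permissible" and h: "((hp, hm), (Wp, Wm)) \<in> jp_permissible"
  shows "jp_map_mult ((gp, gm), (Up, Um)) ((hp, hm), (Wp, Wm)) \<in> jp_permissible"
proof -
  have N: "jp_ideal (Up \<inter> Wp, Um \<inter> Wm)"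
    using jp_ideal_Int jp_permissibleD(2) g h by blast
  \<comment> \<open>The inner map sends \<open>K = (U \<inter> W) * V\<close> into \<open>U \<inter> W\<close>, the domain of the outer one.\<close>
  define Kp Km where "Kp = star_part sp Qp Qm (Up \<inter> Wp) (Um \<inter> Wm)" "Km = star_part sm Qm Qp (Um \<inter> Wm) (Up \<inter> Wp)"
  have K: "jp_ideal (Kp, Km)"
    unfolding Kp_Km_def by (rule jp_ideal_star[OF N])
  have sub: "x \<in> Kp \<Longrightarrow> x \<in> Wp \<and> hp x \<in> Up" "y \<in> Km \<Longrightarrow> y \<in> Wm \<and> hm y \<in> Um" for x y
    using subsetD[OF star_part_subset[OF N]] subsetD[OF star_part_subset_minus[OF N]]
      jp_permissible_star_part[OF h N] jp_permissible_star_part_minus[OF h N]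
    unfolding Kp_Km_def by blast+
  have sub': "x \<in> star_part sp Qp Qm Kp Km \<Longrightarrow> x \<in> Wp \<and> hp x \<in> Up"
    "y \<in> star_part sm Qm Qp Km Kp \<Longrightarrow> y \<in> Wm \<and> hm y \<in> Um" for x y
    using sub subsetD[OF star_part_subset[OF K]] subsetD[OF star_part_subset_minus[OF K]] by blast+
  note D = jp_permissibleD(3,4,8,10)[OF g] jp_permissibleD(3,4,8,10)[OF h]
    jp_permissibleD_minus(3,4,8,10)[OF g] jp_permissibleD_minus(3,4,8,10)[OF h]
  show ?thesis
    unfolding jp_map_mult_def prod.case jp_inter_def jp_star_UNIV Kp_Km_def[symmetric]
  proof (rule jp_permissibleI)
    show "essential_jp_ideal (star_part sp Qp Qm Kp Km, star_part sm Qm Qp Km Kp)"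
      unfolding Kp_Km_def
      by (intro essential_star essential_jp_ideal_Int jp_permissibleD(1)[OF g] jp_permissibleD(1)[OF h])
  qed (auto dest!: sub' simp: D)
qed

lemma jp_permissible_id: "((id, id), (UNIV, UNIV)) \<in> jp_permissible"
  by (rule jp_permissibleI) (simp_all add: essential_jp_ideal_UNIV)

lemma jp_map_equivI:
  "((gp, gm), (Up, Um)) \<in> jp_permissible \<Longrightarrow> ((hp, hm), (Wp, Wm)) \<in> jp_permissible
    \<Longrightarrow> essential_jp_ideal (Xp, Xm) \<Longrightarrow> Xp \<subseteq> Up \<inter> Wp \<Longrightarrow> Xm \<subseteq> Um \<inter> Wm
    \<Longrightarrow> (\<And>x. x \<in> Xp \<Longrightarrow> gp x = hp x) \<Longrightarrow> (\<And>y. y \<in> Xm \<Longrightarrow> gm y = hm y)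
    \<Longrightarrow> (((gp, gm), (Up, Um)), ((hp, hm), (Wp, Wm))) \<in> jp_map_equiv"
  unfolding jp_map_equiv_def mem_Collect_eq prod.case by blast

lemma jp_map_equivE:
  assumes "(((gp, gm), (Up, Um)), ((hp, hm), (Wp, Wm))) \<in> jp_map_equiv"
  obtains Xp Xm where "((gp, gm), (Up, Um)) \<in> jp_permissible" "((hp, hm), (Wp, Wm)) \<in> jp_permissible"
    "essential_jp_ideal (Xp, Xm)" "Xp \<subseteq> Up \<inter> Wp" "Xm \<subseteq> Um \<inter> Wm"
    "\<And>x. x \<in> Xp \<Longrightarrow> gp x = hp x" "\<And>y. y \<in> Xm \<Longrightarrow> gm y = hm y"
  using assms unfolding jp_map_equiv_def mem_Collect_eq prod.case by blast

end

section \<open>Ideals of the Jordan pair and of its Lie algebra\<close>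

definition plus_part :: "('a \<times> 'd::zero \<times> 'b::zero) set \<Rightarrow> 'a set"
  where "plus_part I = {x. (x, 0, 0) \<in> I}"

definition minus_part :: "('a::zero \<times> 'd::zero \<times> 'b) set \<Rightarrow> 'b set"
  where "minus_part I = {y. (0, 0, y) \<in> I}"

context nondegenerate_jordan_pair_half
begin

lemma tkk_zero: "(0 :: ('a, 'b) tkk) = (0, 0, 0)"
  by (simp add: zero_prod_def)

lemma tkk_carrierI: "d \<in> IDer \<Longrightarrow> (x, d, y) \<in> tkk_carrier"
  by (simp add: tkk_carrier_def)

lemma IDer_zero: "0 \<in> IDer"
  by (rule der.subspace_0[OF subspace_IDer])

lemma homogeneous_in_carrier: "(x, 0, 0) \<in> tkk_carrier" "(0, 0, y) \<in> tkk_carrier"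
  by (simp_all add: tkk_carrierI IDer_zero)

lemma inner_der_zero: "inner_der 0 y = 0" "inner_der x 0 = 0"
  using inner_der_add(1)[of 0 0 y] inner_der_add(2)[of x 0 0] by simp_all

lemma lin_der_zero: "lin_der d \<Longrightarrow> fst d 0 = 0" "lin_der d \<Longrightarrow> snd d 0 = 0"
  using lin_der_D(5,6)[of d 0 0] by simp_all

lemma tkk_bracket_homogeneous:
  assumes "e \<in> IDer"
  shows "tkk_bracket (x, 0, 0) (u, e, v) = (- fst e x, inner_der x v, 0)"
    "tkk_bracket (0, 0, y) (u, e, v) = (0, - inner_der u y, - snd e y)"
  using lin_der_zero[OF lin_der_IDer[OF assms]]
  by (simp_all add: tkk_bracket_def inner_der_zero der_commutator_def zero_prod_def split_beta fun_eq_iff)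

lemma IDer_inner: "inner_der x y \<in> IDer" "- inner_der x y \<in> IDer"
  by (simp_all add: inner_der_IDer der.subspace_neg[OF subspace_IDer])

text \<open>Bracketing twice with elements of \<open>V\<^sup>+\<close> (or of \<open>V\<^sup>-\<close>) projects an element of the Lie algebra
  to a triple product containing only its component in \<open>V\<^sup>-\<close> (or in \<open>V\<^sup>+\<close>).\<close>

lemma tkk_double_bracket:
  assumes "e \<in> IDer"
  shows "tkk_bracket (z, 0, 0) (tkk_bracket (x, 0, 0) (u, e, v)) = (- Tp x v z, 0, 0)"
    "tkk_bracket (0, 0, w) (tkk_bracket (0, 0, y) (u, e, v)) = (0, 0, - Tm y u w)"
  by (simp_all add: tkk_bracket_homogeneous assms IDer_inner inner_der_zero fst_snd_bracket)

context
  fixes I assumes I: "tkk.lie_ideal I"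
begin

lemma tkk_ideal_add_scale: "X \<in> I \<Longrightarrow> Y \<in> I \<Longrightarrow> X + Y \<in> I" "X \<in> I \<Longrightarrow> tkk_scale c X \<in> I" "0 \<in> I"
  using I tkk.subspace_add tkk.subspace_scale tkk.subspace_0 unfolding tkk.lie_ideal_def by blast+

lemma tkk_ideal_bracket:
  "X \<in> I \<Longrightarrow> tkk_bracket (x, 0, 0) X \<in> I" "X \<in> I \<Longrightarrow> tkk_bracket (0, 0, y) X \<in> I"
  using I homogeneous_in_carrier unfolding tkk.lie_ideal_def by blast+

lemma tkk_ideal_IDer: "(x, d, y) \<in> I \<Longrightarrow> d \<in> IDer"
  using I unfolding tkk.lie_ideal_def by (auto simp: tkk_carrier_def)

lemma triple_in_parts:
  assumes "(u, d, v) \<in> I"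
  shows "Tp x v z \<in> plus_part I" "Tm y u w \<in> minus_part I"
  using tkk_ideal_bracket(1)[OF tkk_ideal_bracket(1)[OF assms, of x], of "- z"]
    tkk_ideal_bracket(2)[OF tkk_ideal_bracket(2)[OF assms, of y], of "- w"]
  by (simp_all add: tkk_double_bracket tkk_ideal_IDer[OF assms] Tp_minus Tm_minus plus_part_def minus_part_def)

text \<open>In degree 0 the ideal contains at least the inner derivations with one entry in its parts
  of degree \<open>1\<close> and \<open>-1\<close>.\<close>

lemma inner_der_in_ideal:
  "u \<in> plus_part I \<Longrightarrow> (0, inner_der u y, 0) \<in> I" "v \<in> minus_part I \<Longrightarrow> (0, inner_der x v, 0) \<in> I"
  using tkk_ideal_bracket(2)[of "(u, 0, 0)" "- y"] tkk_ideal_bracket(1)[of "(0, 0, v)" x]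
    inner_der_diff(2)[of u 0 y]
  by (simp_all add: plus_part_def minus_part_def tkk_bracket_homogeneous IDer_zero inner_der_zero)

lemma jp_ideal_parts: "jp_ideal (plus_part I, minus_part I)"
proof (rule jp_idealI)
  show "P.subspace (plus_part I)" "M.subspace (minus_part I)"
    using tkk_ideal_add_scale(1)[of "(x, 0, 0)" "(x', 0, 0)" for x x']
      tkk_ideal_add_scale(1)[of "(0, 0, y)" "(0, 0, y')" for y y']
      tkk_ideal_add_scale(2)[of "(x, 0, 0)" c for x c]
      tkk_ideal_add_scale(2)[of "(0, 0, y)" c for y c] tkk_ideal_add_scale(3)
    by (auto simp: P.subspace_def M.subspace_def plus_part_def minus_part_def tkk_scale_def tkk_zero)
next
  fix u y x assume "u \<in> plus_part I"
  then show "Tm y u w \<in> minus_part I" for w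
    using triple_in_parts(2)[of u 0 0] by (simp add: plus_part_def)
  show "Tp u y x \<in> plus_part I"
    using tkk_ideal_bracket(1)[OF inner_der_in_ideal(1)[OF \<open>u \<in> plus_part I\<close>, of y], of "- x"]
    by (simp add: tkk_bracket_homogeneous IDer_inner inner_der_zero fst_snd_bracket Tp_minus plus_part_def)
next
  fix v x y assume "v \<in> minus_part I"
  then show "Tp x v z \<in> plus_part I" for z
    using triple_in_parts(1)[of 0 0 v] by (simp add: minus_part_def)
  show "Tm v x y \<in> minus_part I"
    using tkk_ideal_bracket(2)[OF inner_der_in_ideal(2)[OF \<open>v \<in> minus_part I\<close>, of x], of y]
    by (simp add: tkk_bracket_homogeneous IDer_inner inner_der_zero fst_snd_bracket minus_part_def)
qed

text \<open>By \<open>triple_in_parts\<close> the outer components of an element of \<open>I\<close> are annihilated by all triple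
  products and vanish. The remaining element of degree 0 maps \<open>V\<close> into the zero parts of \<open>I\<close>, so
  it is the zero derivation.\<close>

lemma parts_zero_imp_zero:
  assumes zero: "plus_part I = {0}" "minus_part I = {0}"
  shows "I = {0}"
proof -
  have "X = 0" if "X \<in> I" for X
  proof -
    obtain x d y where X: "X = (x, d, y)"
      by (metis surj_pair)
    note mem = that[unfolded X]
    have "y = 0"
      using triple_in_parts(1)[OF mem] zero by (intro Tp_annihilated_eq_0) auto
    have "x = 0"
      using triple_in_parts(2)[OF mem] zero by (intro Tm_annihilated_eq_0) auto
    have d: "(0, d, 0) \<in> I" "d \<in> IDer"
      using mem tkk_ideal_IDer[OF mem] by (simp_all add: \<open>x = 0\<close> \<open>y = 0\<close>)
    have "- fst d a \<in> plus_part I" "- snd d b \<in> minus_part I" for a b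
      using tkk_ideal_bracket(1)[OF d(1), of a] tkk_ideal_bracket(2)[OF d(1), of b] d(2)
      by (simp_all add: tkk_bracket_homogeneous inner_der_zero plus_part_def minus_part_def)
    then have "fst d a = 0" "snd d b = 0" for a b
      using zero by auto
    then have "d = 0"
      by (simp add: prod_eq_iff fun_eq_iff)
    then show ?thesis
      using X \<open>x = 0\<close> \<open>y = 0\<close> by (simp add: tkk_zero)
  qed
  then show ?thesis
    using tkk_ideal_add_scale(3) by blast
qed

end

text \<open>If \<open>u\<close> lies in an abelian ideal, then \<open>Tp u y u\<close> is the bracket of the two elements
  \<open>u\<close> and \<open>inner_der u y\<close> of this ideal.\<close>

lemma tkk_abelian_ideal_zero:
  assumes Y: "tkk.lie_ideal Y" and ab: "\<And>A B. A \<in> Y \<Longrightarrow> B \<in> Y \<Longrightarrow> tkk_bracket A B = 0"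
  shows "Y = {0}"
proof (rule parts_zero_imp_zero[OF Y])
  note zero = jp_idealD(2)[OF jp_ideal_parts[OF Y]] jp_idealD_minus(2)[OF jp_ideal_parts[OF Y]]
  have "u = 0" if "u \<in> plus_part Y" for u
  proof -
    have "tkk_bracket (u, 0, 0) (0, inner_der u y, 0) = 0" for y
      using inner_der_in_ideal(1)[OF Y that] that by (intro ab) (simp_all add: plus_part_def)
    then have "Qp u y = 0" for y
      by (subst Qp_half) (simp add: tkk_bracket_homogeneous IDer_inner inner_der_zero fst_snd_bracket tkk_zero)
    then show ?thesis
      using nondegenerate_p by blast
  qed
  then show "plus_part Y = {0}"
    using zero by blast
  have "v = 0" if "v \<in> minus_part Y" for v
  proof -
    have "tkk_bracket (0, 0, v) (0, inner_der x v, 0) = 0" for x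
      using inner_der_in_ideal(2)[OF Y that] that by (intro ab) (simp_all add: minus_part_def)
    then have "Qm v x = 0" for x
      by (subst Qm_half) (simp add: tkk_bracket_homogeneous IDer_inner inner_der_zero fst_snd_bracket tkk_zero)
    then show ?thesis
      using nondegenerate_m by blast
  qed
  then show "minus_part Y = {0}"
    using zero by blast
qed

end

sublocale nondegenerate_jordan_pair_half \<subseteq> tkk: semiprime_lie_algebra tkk_scale tkk_carrier tkk_bracket
  by unfold_locales (rule tkk_abelian_ideal_zero)

context nondegenerate_jordan_pair_half
begin

text \<open>The part of degree 0 of the Lie ideal generated by \<open>Up\<close> and \<open>Um\<close>.\<close>

definition der_part :: "'a set \<Rightarrow> 'b set \<Rightarrow> (('a \<Rightarrow> 'a) \<times> ('b \<Rightarrow> 'b)) set"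
  where "der_part Up Um = der.span ({inner_der u y | u y. u \<in> Up} \<union> {inner_der x v | x v. v \<in> Um})"

definition lie_closure :: "'a set \<Rightarrow> 'b set \<Rightarrow> ('a, 'b) tkk set"
  where "lie_closure Up Um = Up \<times> der_part Up Um \<times> Um"

lemma der_part_inner: "u \<in> Up \<Longrightarrow> inner_der u y \<in> der_part Up Um" "v \<in> Um \<Longrightarrow> inner_der x v \<in> der_part Up Um"
  unfolding der_part_def by (rule der.span_base; blast)+

lemma der_part_zero: "0 \<in> der_part Up Um"
  unfolding der_part_def by (rule der.span_zero)

lemma der_part_add_scale: "d \<in> der_part Up Um \<Longrightarrow> e \<in> der_part Up Um \<Longrightarrow> der_scale c d + e \<in> der_part Up Um"
  unfolding der_part_def by (intro der.span_add der.span_scale)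

lemma der_part_add: "d \<in> der_part Up Um \<Longrightarrow> e \<in> der_part Up Um \<Longrightarrow> d + e \<in> der_part Up Um"
  unfolding der_part_def by (rule der.span_add)

lemma der_part_mono: "Up \<subseteq> Wp \<Longrightarrow> Um \<subseteq> Wm \<Longrightarrow> der_part Up Um \<subseteq> der_part Wp Wm"
  unfolding der_part_def by (rule der.span_mono) blast

lemma der_part_subset_IDer: "der_part Up Um \<subseteq> IDer"
  unfolding der_part_def IDer_def by (rule der.span_mono) blast

lemma der_part_induct [consumes 1, case_names zero plus minus]:
  assumes "d \<in> der_part Up Um" and "R 0"
    and "\<And>u y c d. u \<in> Up \<Longrightarrow> d \<in> der_part Up Um \<Longrightarrow> R d \<Longrightarrow> R (der_scale c (inner_der u y) + d)"
    and "\<And>x v c d. v \<in> Um \<Longrightarrow> d \<in> der_part Up Um \<Longrightarrow> R d \<Longrightarrow> R (der_scale c (inner_der x v) + d)"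
  shows "R d"
proof -
  have "d \<in> der_part Up Um \<and> R d"
    using assms(1) unfolding der_part_def[of Up Um]
  proof (induction rule: der.span_induct_alt)
    case base
    then show ?case using assms(2) by (simp add: der.span_zero)
  next
    case (step c k k')
    then have k': "k' \<in> der_part Up Um" "R k'"
      by (simp_all add: der_part_def)
    have "k \<in> der_part Up Um" "R (der_scale c k + k')"
      using step(1) k' assms(3,4) der_part_inner by blast+
    then show ?case
      unfolding der_part_def[symmetric] using k' der_part_add_scale by blast
  qed
  then show ?thesis ..
qed

lemma IDer_eq_der_part: "IDer = der_part UNIV UNIV"
  unfolding IDer_def der_part_def by (rule arg_cong[of _ _ der.span]) auto

context
  fixes Up Um assumes U: "jp_ideal (Up, Um)"
begin

lemma der_part_apply:
  assumes "d \<in> der_part Up Um"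
  shows "fst d x \<in> Up \<and> snd d y \<in> Um"
  using assms
proof (induction rule: der_part_induct)
  case zero
  show ?case
    using jp_idealD(2)[OF U] jp_idealD_minus(2)[OF U] by simp
qed (use jp_idealD[OF U] jp_idealD_minus[OF U] in \<open>simp_all add: der_scale_fst_snd fst_snd_bracket\<close>)

lemma IDer_preserves_ideal:
  assumes "d \<in> IDer"
  shows "(x \<in> Up \<longrightarrow> fst d x \<in> Up) \<and> (y \<in> Um \<longrightarrow> snd d y \<in> Um)"
  using assms unfolding IDer_eq_der_part
proof (induction rule: der_part_induct)
  case zero
  show ?case
    using jp_idealD(2)[OF U] jp_idealD_minus(2)[OF U] by simp
qed (use jp_idealD[OF U] jp_idealD_minus[OF U] in \<open>simp_all add: der_scale_fst_snd fst_snd_bracket\<close>)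

lemma der_commutator_der_part:
  assumes d: "d \<in> IDer" and e: "e \<in> der_part Up Um"
  shows "der_commutator d e \<in> der_part Up Um"
  using e
proof (induction rule: der_part_induct)
  case zero
  have "der_commutator d 0 = 0"
    using der_commutator_lin(1)[OF lin_der_IDer[OF d], of 0 0] by simp
  then show ?case by (simp add: der_part_zero)
next
  case (plus u y c e)
  have "inner_der (fst d u) y + inner_der u (snd d y) \<in> der_part Up Um"
    using plus(1) IDer_preserves_ideal[OF d]
    by (intro der_part_add) (simp_all add: der_part_inner)
  then show ?case
    using plus(3) der_commutator_lin[OF lin_der_IDer[OF d]] lin_der_D(7)[OF lin_der_IDer[OF d]]
    by (simp only: der_part_add_scale)
next
  case (minus x v c e)
  have "inner_der (fst d x) v + inner_der x (snd d v) \<in> der_part Up Um"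
    using minus(1) IDer_preserves_ideal[OF d]
    by (intro der_part_add) (simp_all add: der_part_inner)
  then show ?case
    using minus(3) der_commutator_lin[OF lin_der_IDer[OF d]] lin_der_D(7)[OF lin_der_IDer[OF d]]
    by (simp only: der_part_add_scale)
qed

lemma lie_ideal_closure: "tkk.lie_ideal (lie_closure Up Um)"
  unfolding tkk.lie_ideal_def
proof (intro conjI ballI)
  have der: "der.subspace (der_part Up Um)"
    unfolding der_part_def by (rule der.subspace_span)
  show "tkk.subspace (lie_closure Up Um)"
    using jp_idealD(2-4)[OF U] jp_idealD_minus(2-4)[OF U] der
    by (auto simp: tkk.subspace_def der.subspace_def lie_closure_def tkk_scale_def tkk_zero)
  show "lie_closure Up Um \<subseteq> tkk_carrier"
    using der_part_subset_IDer by (auto simp: lie_closure_def tkk_carrier_def)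
  fix X Y assume X: "X \<in> tkk_carrier" and Y: "Y \<in> lie_closure Up Um"
  obtain x d y u e v where eqs: "X = (x, d, y)" "Y = (u, e, v)"
    by (metis surj_pair)
  have d: "d \<in> IDer" and Y: "u \<in> Up" "e \<in> der_part Up Um" "v \<in> Um"
    using X Y by (simp_all add: eqs tkk_carrier_def lie_closure_def)
  have "inner_der x v - inner_der u y + der_commutator d e \<in> der_part Up Um"
    using Y der_commutator_der_part[OF d Y(2)]
    by (intro der.subspace_add[OF der] der.subspace_diff[OF der]) (auto intro: der_part_inner)
  then show "tkk_bracket X Y \<in> lie_closure Up Um"
    using Y IDer_preserves_ideal[OF d] der_part_apply[OF Y(2)] jp_idealD(6)[OF U] jp_idealD_minus(6)[OF U]
    by (simp add: eqs tkk_bracket_def lie_closure_def)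
qed

lemma parts_of_closure: "plus_part (lie_closure Up Um) = Up" "minus_part (lie_closure Up Um) = Um"
  using jp_idealD(2)[OF U] jp_idealD_minus(2)[OF U] der_part_zero
  by (auto simp: plus_part_def minus_part_def lie_closure_def)

end

lemma parts_Int: "plus_part (I \<inter> J) = plus_part I \<inter> plus_part J" "minus_part (I \<inter> J) = minus_part I \<inter> minus_part J"
  by (auto simp: plus_part_def minus_part_def)

lemma parts_nonzero: "tkk.lie_ideal I \<Longrightarrow> I \<noteq> {0} \<Longrightarrow> (plus_part I, minus_part I) \<noteq> ({0}, {0})"
  using parts_zero_imp_zero by blast

text \<open>A nonzero ideal \<open>W\<close> of the pair generates a nonzero Lie ideal. Its intersection with \<open>I\<close> is
  nonzero, hence has a nonzero part in degree \<open>1\<close> or \<open>-1\<close>, and that part lies in \<open>W\<close>.\<close>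

lemma essential_parts:
  assumes I: "tkk.essential_lie_ideal I"
  shows "essential_jp_ideal (plus_part I, minus_part I)"
proof (rule essential_jp_idealI)
  note I' = tkk.essential_imp_ideal[OF I]
  show "jp_ideal (plus_part I, minus_part I)"
    by (rule jp_ideal_parts[OF I'])
  fix Wp Wm assume W: "jp_ideal (Wp, Wm)" "(Wp, Wm) \<noteq> ({0}, {0})"
  have "lie_closure Wp Wm \<noteq> {0}"
  proof
    assume "lie_closure Wp Wm = {0}"
    then have "plus_part (lie_closure Wp Wm) = {0}" "minus_part (lie_closure Wp Wm) = {0}"
      by (auto simp: plus_part_def minus_part_def tkk_zero)
    then show False
      using W(2) unfolding parts_of_closure[OF W(1)] by simp
  qed
  then have "I \<inter> lie_closure Wp Wm \<noteq> {0}"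
    using I lie_ideal_closure[OF W(1)] unfolding tkk.essential_lie_ideal_def by blast
  then have "(plus_part (I \<inter> lie_closure Wp Wm), minus_part (I \<inter> lie_closure Wp Wm)) \<noteq> ({0}, {0})"
    by (intro parts_nonzero tkk.lie_ideal_Int I' lie_ideal_closure W)
  then show "(plus_part I \<inter> Wp, minus_part I \<inter> Wm) \<noteq> ({0}, {0})"
    by (simp only: parts_Int parts_of_closure[OF W(1)] not_False_eq_True)
qed

lemma essential_closure:
  assumes U: "essential_jp_ideal (Up, Um)"
  shows "tkk.essential_lie_ideal (lie_closure Up Um)"
  unfolding tkk.essential_lie_ideal_def
proof (intro conjI allI impI)
  note U' = essential_jp_idealD[OF U]
  show "tkk.lie_ideal (lie_closure Up Um)"
    by (rule lie_ideal_closure[OF U'])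
  fix J assume J: "tkk.lie_ideal J \<and> J \<noteq> {0}"
  show "lie_closure Up Um \<inter> J \<noteq> {0}"
  proof
    assume "lie_closure Up Um \<inter> J = {0}"
    then have "(Up \<inter> plus_part J, Um \<inter> minus_part J) = ({0}, {0})"
      using parts_Int[of "lie_closure Up Um" J] unfolding parts_of_closure[OF U']
      by (simp add: plus_part_def minus_part_def tkk_zero)
    then show False
      using essential_jp_ideal_meets[OF U jp_ideal_parts parts_nonzero] J by blast
  qed
qed

end

section \<open>Extending permissible maps to the Lie algebra\<close>

context nondegenerate_jordan_pair_half
begin

definition tkk_extend :: "('a \<Rightarrow> 'a) \<Rightarrow> ('b \<Rightarrow> 'b) \<Rightarrow> ('a, 'b) tkk \<Rightarrow> ('a, 'b) tkk"
  where "tkk_extend gp gm = (\<lambda>(x, d, y). (gp x, (gp \<circ> fst d, gm \<circ> snd d), gm y))"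

definition tkk_map :: "('a, 'b) jp_map \<Rightarrow> (('a, 'b) tkk \<Rightarrow> ('a, 'b) tkk) \<times> ('a, 'b) tkk set"
  where "tkk_map = (\<lambda>((gp, gm), (Up, Um)). (tkk_extend gp gm, lie_closure Up Um))"

context
  fixes gp gm Up Um assumes g: "((gp, gm), (Up, Um)) \<in> jp_permissible"
begin

lemmas gD = jp_permissibleD[OF g]
lemmas gDm = jp_permissibleD_minus[OF g]

lemma extend_inner_der:
  "u \<in> Up \<Longrightarrow> (gp \<circ> fst (inner_der u y), gm \<circ> snd (inner_der u y)) = inner_der (gp u) y"
  "v \<in> Um \<Longrightarrow> (gp \<circ> fst (inner_der x v), gm \<circ> snd (inner_der x v)) = inner_der x (gm v)"
  using jp_idealD_minus[OF gD(2)]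
  by (auto simp: inner_der_def fun_eq_iff gD gDm)

lemma extend_zero: "(gp \<circ> fst (0 :: ('a \<Rightarrow> 'a) \<times> ('b \<Rightarrow> 'b)), gm \<circ> snd (0 :: ('a \<Rightarrow> 'a) \<times> ('b \<Rightarrow> 'b))) = 0"
  by (simp add: prod_eq_iff fun_eq_iff gD(5) gDm(5))

lemma extend_add_scale:
  assumes d: "d \<in> der_part Up Um" and e: "e \<in> der_part Up Um"
  shows "(gp \<circ> fst (der_scale c d + e), gm \<circ> snd (der_scale c d + e)) =
    der_scale c (gp \<circ> fst d, gm \<circ> snd d) + (gp \<circ> fst e, gm \<circ> snd e)"
  using der_part_apply[OF gD(2) d] der_part_apply[OF gD(2) e] jp_idealD(4)[OF gD(2)] jp_idealD_minus(4)[OF gD(2)]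
  by (simp add: prod_eq_iff fun_eq_iff der_scale_fst_snd gD gDm)

text \<open>The composite \<open>g \<circ> d\<close> is again an inner derivation: on generators this is \<open>extend_inner_der\<close>, and
  \<open>d \<mapsto> g \<circ> d\<close> is linear.\<close>

lemma extend_IDer:
  assumes "d \<in> der_part Up Um"
  shows "(gp \<circ> fst d, gm \<circ> snd d) \<in> IDer"
  using assms
proof (induction rule: der_part_induct)
  case zero
  show ?case by (simp only: extend_zero IDer_zero)
next
  case (plus u y c d)
  then show ?case
    unfolding extend_add_scale[OF der_part_inner(1)[OF plus(1)] plus(2)] extend_inner_der(1)[OF plus(1)]
    by (intro der.subspace_add[OF subspace_IDer] der.subspace_scale[OF subspace_IDer] inner_der_IDer)
next
  case (minus x v c d)
  then show ?case
    unfolding extend_add_scale[OF der_part_inner(2)[OF minus(1)] minus(2)] extend_inner_der(2)[OF minus(1)]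
    by (intro der.subspace_add[OF subspace_IDer] der.subspace_scale[OF subspace_IDer] inner_der_IDer)
qed

text \<open>A \<open>V\<close>-homomorphism commutes with the operators \<open>Tp x y\<close> and \<open>Tm y x\<close>, hence with all inner
  derivations. This is what makes the extension commute with brackets.\<close>

lemma commute_IDer:
  assumes "d \<in> IDer"
  shows "(x \<in> Up \<longrightarrow> gp (fst d x) = fst d (gp x)) \<and> (y \<in> Um \<longrightarrow> gm (snd d y) = snd d (gm y))"
proof -
  note U = jp_idealD[OF gD(2)] and U' = jp_idealD_minus[OF gD(2)]
  note stable = IDer_preserves_ideal[OF gD(2)]
  show ?thesis
    using assms unfolding IDer_eq_der_part
  proof (induction rule: der_part_induct)
    case zero
    show ?case by (simp add: gD gDm)
  next
    case (plus u y c d)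
    then show ?case
      using stable[of d] by (simp add: IDer_eq_der_part der_scale_fst_snd fst_snd_bracket U U' gD gDm)
  next
    case (minus u y c d)
    then show ?case
      using stable[of d] by (simp add: IDer_eq_der_part der_scale_fst_snd fst_snd_bracket U U' gD gDm)
  qed
qed

lemma extend_bracket:
  assumes X: "X \<in> tkk_carrier" and Y: "Y \<in> lie_closure Up Um"
  shows "tkk_extend gp gm (tkk_bracket X Y) = tkk_bracket X (tkk_extend gp gm Y)"
proof -
  obtain x d y u e v where eqs: "X = (x, d, y)" "Y = (u, e, v)"
    by (metis surj_pair)
  have d: "d \<in> IDer" and u: "u \<in> Up" and e: "e \<in> der_part Up Um" and v: "v \<in> Um"
    using X Y by (simp_all add: eqs tkk_carrier_def lie_closure_def)
  note U = jp_idealD[OF gD(2)] and U' = jp_idealD_minus[OF gD(2)]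
  note st = IDer_preserves_ideal[OF gD(2) d]
  note e' = der_part_apply[OF gD(2) e]
  note comm = commute_IDer[OF d]
  have 1: "gp (fst d u - fst e x) = fst d (gp u) - gp (fst e x)"
    "gm (snd d v - snd e y) = snd d (gm v) - gm (snd e y)"
    using st e' comm u v by (simp_all add: gD gDm)
  have "gp (fst (inner_der x v - inner_der u y + der_commutator d e) z)
      = fst (inner_der x (gm v) - inner_der (gp u) y + der_commutator d (gp \<circ> fst e, gm \<circ> snd e)) z" for z
    using st e' comm u v by (simp add: fst_snd_bracket gD U)
  moreover have "gm (snd (inner_der x v - inner_der u y + der_commutator d e) z)
      = snd (inner_der x (gm v) - inner_der (gp u) y + der_commutator d (gp \<circ> fst e, gm \<circ> snd e)) z" for z
    using st e' comm u v by (simp add: fst_snd_bracket gDm U')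
  ultimately show ?thesis
    by (simp add: eqs tkk_bracket_def tkk_extend_def 1 prod_eq_iff fun_eq_iff)
qed

lemma tkk_map_permissible: "tkk_map ((gp, gm), (Up, Um)) \<in> tkk.lie_permissible"
  unfolding tkk_map_def tkk.lie_permissible_def mem_Collect_eq prod.case
proof (intro conjI ballI extend_bracket)
  show "tkk.essential_lie_ideal (lie_closure Up Um)"
    by (rule essential_closure[OF gD(1)])
  show "tkk_extend gp gm ` lie_closure Up Um \<subseteq> tkk_carrier"
    using extend_IDer by (auto simp: lie_closure_def tkk_extend_def tkk_carrier_def)
  fix X Y assume "X \<in> lie_closure Up Um" "Y \<in> lie_closure Up Um"
  then show "tkk_extend gp gm (X + Y) = tkk_extend gp gm X + tkk_extend gp gm Y"
    using extend_add_scale[where c = 1]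
    by (auto simp: lie_closure_def tkk_extend_def gD gDm)
qed

end

text \<open>The extension is determined by the values on \<open>V\<close>, because \<open>g \<circ> d\<close> only involves values of \<open>g\<close> on
  the image of \<open>d\<close>.\<close>

lemma tkk_map_equiv_iff:
  assumes g: "((gp, gm), (Up, Um)) \<in> jp_permissible" and h: "((hp, hm), (Wp, Wm)) \<in> jp_permissible"
  shows "(((gp, gm), (Up, Um)), ((hp, hm), (Wp, Wm))) \<in> jp_map_equiv \<longleftrightarrow>
    (tkk_map ((gp, gm), (Up, Um)), tkk_map ((hp, hm), (Wp, Wm))) \<in> tkk.lie_map_equiv"
proof
  assume "(((gp, gm), (Up, Um)), ((hp, hm), (Wp, Wm))) \<in> jp_map_equiv"
  then obtain Xp Xm where X: "essential_jp_ideal (Xp, Xm)" "Xp \<subseteq> Up \<inter> Wp" "Xm \<subseteq> Um \<inter> Wm"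
    "\<And>x. x \<in> Xp \<Longrightarrow> gp x = hp x" "\<And>y. y \<in> Xm \<Longrightarrow> gm y = hm y"
    by (rule jp_map_equivE) blast
  have eq: "tkk_extend gp gm Z = tkk_extend hp hm Z" if "Z \<in> lie_closure Xp Xm" for Z
    using that der_part_apply[OF essential_jp_idealD[OF X(1)]] X(4,5)
    by (auto simp: lie_closure_def tkk_extend_def fun_eq_iff)
  have sub: "lie_closure Xp Xm \<subseteq> lie_closure Up Um" "lie_closure Xp Xm \<subseteq> lie_closure Wp Wm"
    using X(2,3) der_part_mono[of Xp Up Xm Um] der_part_mono[of Xp Wp Xm Wm] unfolding lie_closure_def by auto
  show "(tkk_map ((gp, gm), (Up, Um)), tkk_map ((hp, hm), (Wp, Wm))) \<in> tkk.lie_map_equiv"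
    using tkk_map_permissible[OF g] tkk_map_permissible[OF h] unfolding tkk_map_def prod.case
    by (rule tkk.lie_map_equivI) (rule essential_closure[OF X(1)] sub eq; assumption?)+
next
  assume "(tkk_map ((gp, gm), (Up, Um)), tkk_map ((hp, hm), (Wp, Wm))) \<in> tkk.lie_map_equiv"
  then obtain Y where Y: "tkk.essential_lie_ideal Y" "Y \<subseteq> lie_closure Up Um" "Y \<subseteq> lie_closure Wp Wm"
    "\<And>Z. Z \<in> Y \<Longrightarrow> tkk_extend gp gm Z = tkk_extend hp hm Z"
    unfolding tkk_map_def prod.case by (rule tkk.lie_map_equivE) blast
  show "(((gp, gm), (Up, Um)), ((hp, hm), (Wp, Wm))) \<in> jp_map_equiv"
    using g h
  proof (rule jp_map_equivI)
    show "essential_jp_ideal (plus_part Y, minus_part Y)"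
      by (rule essential_parts[OF Y(1)])
    show "plus_part Y \<subseteq> Up \<inter> Wp" "minus_part Y \<subseteq> Um \<inter> Wm"
      using Y(2,3) by (auto simp: plus_part_def minus_part_def lie_closure_def)
    show "gp x = hp x" if "x \<in> plus_part Y" for x
      using Y(4)[of "(x, 0, 0)"] that by (simp add: plus_part_def tkk_extend_def)
    show "gm y = hm y" if "y \<in> minus_part Y" for y
      using Y(4)[of "(0, 0, y)"] that by (simp add: minus_part_def tkk_extend_def)
  qed
qed

text \<open>The degree \<open>1\<close> component is the centralizer of \<open>V\<^sup>+\<close>: if \<open>(a, d, b)\<close> commutes with all
  \<open>(z, 0, 0)\<close>, then \<open>inner_der z b = 0\<close> forces \<open>b = 0\<close>, and \<open>d\<close> vanishes on \<open>V\<^sup>+\<close>. Applying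
  \<open>d\<close> to the triple products on \<open>V\<^sup>+\<close> then gives \<open>Tp x (snd d v) z = 0\<close>, hence \<open>d = 0\<close>.\<close>

lemma centralizer_plus:
  assumes "(a, d, b) \<in> tkk_carrier" and comm: "\<And>z. tkk_bracket (z, 0, 0) (a, d, b) = 0"
  shows "d = 0 \<and> b = 0"
proof -
  have d: "d \<in> IDer"
    using assms(1) by (simp add: tkk_carrier_def)
  have eq: "fst d z = 0" "inner_der z b = 0" for z
    using comm[of z] by (simp_all add: tkk_bracket_homogeneous d tkk_zero)
  have "fst (inner_der z b) x = 0" for x z
    using eq(2) by simp
  then have b: "b = 0"
    by (intro Tp_annihilated_eq_0) (simp add: fst_snd_bracket)
  have "Tp x (snd d v) z = 0" for x v z
  proof -
    have "fst (der_commutator d (inner_der x v)) z = 0"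
      by (simp add: fst_snd_bracket eq T_zero)
    then show ?thesis
      using lin_der_D(7)[OF lin_der_IDer[OF d], of x v] by (simp add: eq inner_der_zero fst_snd_bracket)
  qed
  then have "snd d v = 0" for v
    by (rule Tp_annihilated_eq_0)
  then show ?thesis
    using eq b by (simp add: prod_eq_iff fun_eq_iff)
qed

lemma centralizer_minus:
  assumes "(a, d, b) \<in> tkk_carrier" and comm: "\<And>z. tkk_bracket (0, 0, z) (a, d, b) = 0"
  shows "d = 0 \<and> a = 0"
proof -
  have d: "d \<in> IDer"
    using assms(1) by (simp add: tkk_carrier_def)
  have eq: "snd d z = 0" "inner_der a z = 0" for z
    using comm[of z] by (simp_all add: tkk_bracket_homogeneous d tkk_zero)
  have "snd (inner_der a z) y = 0" for y z
    using eq(2) by simp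
  then have a: "a = 0"
    by (intro Tm_annihilated_eq_0) (simp add: fst_snd_bracket)
  have "Tm y (fst d u) z = 0" for y u z
  proof -
    have "snd (der_commutator d (inner_der u y)) z = 0"
      by (simp add: fst_snd_bracket eq T_zero)
    then show ?thesis
      using lin_der_D(7)[OF lin_der_IDer[OF d], of u y] by (simp add: eq inner_der_zero fst_snd_bracket)
  qed
  then have "fst d u = 0" for u
    by (rule Tm_annihilated_eq_0)
  then show ?thesis
    using eq a by (simp add: prod_eq_iff fun_eq_iff)
qed

section \<open>Restricting permissible maps to the Jordan pair\<close>

context
  fixes f I assumes f: "(f, I) \<in> tkk.lie_permissible"
begin

definition plus_map where "plus_map x = fst (f (x, 0, 0))"
definition minus_map where "minus_map y = snd (snd (f (0, 0, y)))"

lemmas fD = tkk.permissibleD[OF f] and f_scale = tkk.permissible_scale[OF f] and f_zero = tkk.permissible_zero[OF f]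

text \<open>An element of \<open>V\<^sup>+\<close> commutes with \<open>V\<^sup>+\<close>, so its image under \<open>f\<close> does as well and lies in
  \<open>V\<^sup>+\<close> by \<open>centralizer_plus\<close>.\<close>

lemma f_homogeneous:
  "x \<in> plus_part I \<Longrightarrow> f (x, 0, 0) = (plus_map x, 0, 0)"
  "y \<in> minus_part I \<Longrightarrow> f (0, 0, y) = (0, 0, minus_map y)"
proof -
  assume "x \<in> plus_part I"
  then have x: "(x, 0, 0) \<in> I" by (simp add: plus_part_def)
  obtain a d b where fx: "f (x, 0, 0) = (a, d, b)"
    by (metis surj_pair)
  have "tkk_bracket (z, 0, 0) (a, d, b) = 0" for z
    using fD(5)[OF homogeneous_in_carrier(1) x, of z] f_zero
    by (simp add: fx tkk_bracket_homogeneous IDer_zero inner_der_zero flip: tkk_zero)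
  then have "d = 0 \<and> b = 0"
    using fD(3)[OF x] unfolding fx by (intro centralizer_plus)
  then show "f (x, 0, 0) = (plus_map x, 0, 0)"
    by (simp add: plus_map_def fx)
next
  assume "y \<in> minus_part I"
  then have y: "(0, 0, y) \<in> I" by (simp add: minus_part_def)
  obtain a d b where fy: "f (0, 0, y) = (a, d, b)"
    by (metis surj_pair)
  have "tkk_bracket (0, 0, z) (a, d, b) = 0" for z
    using fD(5)[OF homogeneous_in_carrier(2) y, of z] f_zero
    by (simp add: fy tkk_bracket_homogeneous IDer_zero inner_der_zero flip: tkk_zero)
  then have "d = 0 \<and> a = 0"
    using fD(3)[OF y] unfolding fy by (intro centralizer_minus)
  then show "f (0, 0, y) = (0, 0, minus_map y)"
    by (simp add: minus_map_def fy)
qed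

lemma f_inner_der:
  "u \<in> plus_part I \<Longrightarrow> f (0, inner_der u y, 0) = (0, inner_der (plus_map u) y, 0)"
  "v \<in> minus_part I \<Longrightarrow> f (0, inner_der x v, 0) = (0, inner_der x (minus_map v), 0)"
proof -
  have neg: "- inner_der u (- y) = inner_der u y" for u y
    using inner_der_diff(2)[of u 0 y] by (simp add: inner_der_zero)
  assume u: "u \<in> plus_part I"
  then have "f (tkk_bracket (0, 0, - y) (u, 0, 0)) = tkk_bracket (0, 0, - y) (plus_map u, 0, 0)"
    using fD(5)[OF homogeneous_in_carrier(2)] f_homogeneous(1)[OF u] by (simp add: plus_part_def)
  then show "f (0, inner_der u y, 0) = (0, inner_der (plus_map u) y, 0)"
    by (simp add: tkk_bracket_homogeneous IDer_zero neg)
next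
  assume v: "v \<in> minus_part I"
  then have "f (tkk_bracket (x, 0, 0) (0, 0, v)) = tkk_bracket (x, 0, 0) (0, 0, minus_map v)"
    using fD(5)[OF homogeneous_in_carrier(1)] f_homogeneous(2)[OF v] by (simp add: minus_part_def)
  then show "f (0, inner_der x v, 0) = (0, inner_der x (minus_map v), 0)"
    by (simp add: tkk_bracket_homogeneous IDer_zero)
qed

lemma f_bracket:
  assumes "X \<in> I"
  shows "f (tkk_bracket (x, 0, 0) X) = tkk_bracket (x, 0, 0) (f X)"
    "f (tkk_bracket (0, 0, y) X) = tkk_bracket (0, 0, y) (f X)"
  using fD(5) homogeneous_in_carrier assms by blast+

lemmas bracket_inner_der = tkk_bracket_homogeneous[OF inner_der_IDer] inner_der_zero fst_snd_bracket

text \<open>Every triple product is a bracket of an inner derivation with an element of \<open>V\<close>, so the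
  conditions on a \<open>V\<close>-homomorphism follow from \<open>f_inner_der\<close>.\<close>

lemma parts_maps_permissible: "((plus_map, minus_map), (plus_part I, minus_part I)) \<in> jp_permissible"
proof (rule jp_permissibleI)
  show "essential_jp_ideal (plus_part I, minus_part I)"
    by (rule essential_parts[OF fD(1)])
  show "plus_map (x + y) = plus_map x + plus_map y" if "x \<in> plus_part I" "y \<in> plus_part I" for x y
    using that fD(4)[of "(x, 0, 0)" "(y, 0, 0)"] by (simp add: plus_part_def plus_map_def)
  show "minus_map (x + y) = minus_map x + minus_map y" if "x \<in> minus_part I" "y \<in> minus_part I" for x y
    using that fD(4)[of "(0, 0, x)" "(0, 0, y)"] by (simp add: minus_part_def minus_map_def)
  show "plus_map (sp c x) = sp c (plus_map x)" if "x \<in> plus_part I" for x c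
    using that f_scale[of "(x, 0, 0)" c] by (simp add: plus_part_def plus_map_def tkk_scale_def split_beta)
  show "minus_map (sm c x) = sm c (minus_map x)" if "x \<in> minus_part I" for x c
    using that f_scale[of "(0, 0, x)" c] by (simp add: minus_part_def minus_map_def tkk_scale_def split_beta)
next
  fix u y x w assume u: "u \<in> plus_part I"
  note mem = inner_der_in_ideal(1)[OF fD(2) u, of y]
  show "plus_map (Tp u y x) = Tp (plus_map u) y x"
    using f_bracket(1)[OF mem, of "- x"]
    by (simp add: bracket_inner_der f_inner_der(1)[OF u] plus_map_def Tp_minus)
  show "minus_map (Tm y u w) = Tm y (plus_map u) w"
    using f_bracket(2)[OF mem, of w]
    by (simp add: bracket_inner_der f_inner_der(1)[OF u] minus_map_def)
next
  fix v x y z assume v: "v \<in> minus_part I"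
  note mem = inner_der_in_ideal(2)[OF fD(2) v, of x]
  show "plus_map (Tp x v z) = Tp x (minus_map v) z"
    using f_bracket(1)[OF mem, of "- z"]
    by (simp add: bracket_inner_der f_inner_der(2)[OF v] plus_map_def Tp_minus)
  show "minus_map (Tm v x y) = Tm (minus_map v) x y"
    using f_bracket(2)[OF mem, of y]
    by (simp add: bracket_inner_der f_inner_der(2)[OF v] minus_map_def)
qed

text \<open>On \<open>inner_der u y\<close> both maps have the value \<open>inner_der (plus_map u) y\<close>; the general case follows
  by linearity of both.\<close>

lemma extend_parts_maps:
  assumes d: "d \<in> der_part (plus_part I) (minus_part I)"
  shows "(0, d, 0) \<in> I \<and> f (0, d, 0) = (0, (plus_map \<circ> fst d, minus_map \<circ> snd d), 0)"
  using d
proof (induction rule: der_part_induct)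
  note g = parts_maps_permissible
  have step: "(0, der_scale c e + d, 0) \<in> I \<and> f (0, der_scale c e + d, 0)
      = (0, (plus_map \<circ> fst (der_scale c e + d), minus_map \<circ> snd (der_scale c e + d)), 0)"
    if "(0, e, 0) \<in> I" "(0, d, 0) \<in> I" "e \<in> der_part (plus_part I) (minus_part I)"
      "d \<in> der_part (plus_part I) (minus_part I)"
      "f (0, e, 0) = (0, (plus_map \<circ> fst e, minus_map \<circ> snd e), 0)"
      "f (0, d, 0) = (0, (plus_map \<circ> fst d, minus_map \<circ> snd d), 0)" for c d e
  proof -
    have eq: "(0, der_scale c e + d, 0) = tkk_scale c (0, e, 0) + (0, d, 0)"
      by (simp add: tkk_scale_def)
    have scaled: "tkk_scale c (0, e, 0) \<in> I"
      by (rule tkk_ideal_add_scale(2)[OF fD(2) that(1)])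
    have "f (tkk_scale c (0, e, 0) + (0, d, 0)) = tkk_scale c (f (0, e, 0)) + f (0, d, 0)"
      by (simp only: fD(4)[OF scaled that(2)] f_scale[OF that(1)])
    then show ?thesis
      unfolding eq extend_add_scale[OF g that(3,4)] that(5,6)
      using tkk_ideal_add_scale(1)[OF fD(2) scaled that(2)] by (simp add: tkk_scale_def)
  qed
  {
    case zero
    show ?case
      using f_zero tkk_ideal_add_scale(3)[OF fD(2)] by (simp only: tkk_zero extend_zero[OF g])
  next
    case (plus u y c d)
    then show ?case
      using inner_der_in_ideal(1)[OF fD(2)] f_inner_der(1) extend_inner_der(1)[OF g] der_part_inner
      by (intro step) (simp_all add: comp_def)
  next
    case (minus x v c d)
    then show ?case
      using inner_der_in_ideal(2)[OF fD(2)] f_inner_der(2) extend_inner_der(2)[OF g] der_part_inner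
      by (intro step) (simp_all add: comp_def)
  }
qed

lemma tkk_map_surjective:
  "(tkk_map ((plus_map, minus_map), (plus_part I, minus_part I)), (f, I)) \<in> tkk.lie_map_equiv"
proof -
  have eq: "X \<in> I \<and> tkk_extend plus_map minus_map X = f X" if "X \<in> lie_closure (plus_part I) (minus_part I)" for X
  proof -
    obtain u d v where X: "X = (u, 0, 0) + ((0, d, 0) + (0, 0, v))"
      and mem: "u \<in> plus_part I" "d \<in> der_part (plus_part I) (minus_part I)" "v \<in> minus_part I"
      using \<open>X \<in> _\<close> by (auto simp: lie_closure_def)
    have I: "(u, 0, 0) \<in> I" "(0, d, 0) \<in> I" "(0, 0, v) \<in> I" "(0, d, 0) + (0, 0, v) \<in> I"
      using mem extend_parts_maps[OF mem(2)] tkk_ideal_add_scale(1)[OF fD(2), of "(0, d, 0)" "(0, 0, v)"]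
      by (simp_all add: plus_part_def minus_part_def)
    have "f X = f (u, 0, 0) + (f (0, d, 0) + f (0, 0, v))"
      unfolding X using fD(4) I by presburger
    also have "\<dots> = tkk_extend plus_map minus_map X"
      using extend_parts_maps[OF mem(2)] f_homogeneous mem
      by (simp add: X tkk_extend_def)
    finally show ?thesis
      using tkk_ideal_add_scale(1)[OF fD(2) I(1,4)] X by simp
  qed
  show ?thesis
    using tkk_map_permissible[OF parts_maps_permissible] f eq essential_closure[OF essential_parts[OF fD(1)]]
    unfolding tkk_map_def prod.case by (intro tkk.lie_map_equivI) blast+
qed

end

section \<open>The isomorphism\<close>

text \<open>The extension of a sum or a product of maps agrees everywhere with the sum or product of the
  extensions; only the domains differ.\<close>

lemma equal_maps_equiv:
  assumes "(f, I) \<in> tkk.lie_permissible" "(f', I') \<in> tkk.lie_permissible" "f = f'"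
  shows "((f, I), (f', I')) \<in> tkk.lie_map_equiv"
  using assms tkk.essential_Int[OF tkk.permissibleD(1)[OF assms(1)] tkk.permissibleD(1)[OF assms(2)]]
  by (intro tkk.lie_map_equivI[where X = "I \<inter> I'"]) auto

lemma tkk_map_in_permissible: "m \<in> jp_permissible \<Longrightarrow> tkk_map m \<in> tkk.lie_permissible"
  using tkk_map_permissible by (metis surj_pair)

lemma tkk_map_add:
  assumes "m \<in> jp_permissible" "n \<in> jp_permissible"
  shows "jp_map_add m n \<in> jp_permissible"
    "(tkk_map (jp_map_add m n), tkk.lie_map_add (tkk_map m) (tkk_map n)) \<in> tkk.lie_map_equiv"
proof -
  obtain gp gm Up Um hp hm Wp Wm where eqs: "m = ((gp, gm), (Up, Um))" "n = ((hp, hm), (Wp, Wm))"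
    by (metis surj_pair)
  show mem: "jp_map_add m n \<in> jp_permissible"
    using assms jp_map_add_permissible unfolding eqs by blast
  have "tkk_map (jp_map_add m n) \<in> tkk.lie_permissible"
    "tkk.lie_map_add (tkk_map m) (tkk_map n) \<in> tkk.lie_permissible"
    using tkk_map_in_permissible[OF mem] assms tkk.lie_permissible_add tkk_map_permissible
    unfolding eqs tkk_map_def prod.case by simp_all
  moreover have "tkk_extend (\<lambda>x. gp x + hp x) (\<lambda>y. gm y + hm y) = (\<lambda>X. tkk_extend gp gm X + tkk_extend hp hm X)"
    by (auto simp: tkk_extend_def fun_eq_iff)
  ultimately show "(tkk_map (jp_map_add m n), tkk.lie_map_add (tkk_map m) (tkk_map n)) \<in> tkk.lie_map_equiv"
    unfolding eqs jp_map_add_def tkk.lie_map_add_def tkk_map_def prod.case jp_inter_def jp_star_UNIV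
    by (rule equal_maps_equiv)
qed

lemma tkk_map_mult:
  assumes "m \<in> jp_permissible" "n \<in> jp_permissible"
  shows "jp_map_mult m n \<in> jp_permissible"
    "(tkk_map (jp_map_mult m n), tkk.lie_map_mult (tkk_map m) (tkk_map n)) \<in> tkk.lie_map_equiv"
proof -
  obtain gp gm Up Um hp hm Wp Wm where eqs: "m = ((gp, gm), (Up, Um))" "n = ((hp, hm), (Wp, Wm))"
    by (metis surj_pair)
  show mem: "jp_map_mult m n \<in> jp_permissible"
    using assms jp_map_mult_permissible unfolding eqs by blast
  have "tkk_map (jp_map_mult m n) \<in> tkk.lie_permissible"
    "tkk.lie_map_mult (tkk_map m) (tkk_map n) \<in> tkk.lie_permissible"
    using tkk_map_in_permissible[OF mem] assms tkk.lie_permissible_mult tkk_map_permissible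
    unfolding eqs tkk_map_def prod.case by simp_all
  moreover have "tkk_extend (gp \<circ> hp) (gm \<circ> hm) = tkk_extend gp gm \<circ> tkk_extend hp hm"
    by (auto simp: tkk_extend_def fun_eq_iff)
  ultimately show "(tkk_map (jp_map_mult m n), tkk.lie_map_mult (tkk_map m) (tkk_map n)) \<in> tkk.lie_map_equiv"
    unfolding eqs jp_map_mult_def tkk.lie_map_mult_def tkk_map_def prod.case jp_inter_def jp_star_UNIV
    by (rule equal_maps_equiv)
qed

lemma tkk_map_id: "(tkk_map ((id, id), (UNIV, UNIV)), (id, tkk_carrier)) \<in> tkk.lie_map_equiv"
proof -
  have "tkk_extend id id = id"
    by (auto simp: tkk_extend_def fun_eq_iff)
  then show ?thesis
    using tkk_map_permissible[OF jp_permissible_id] tkk.lie_permissible_id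
    unfolding tkk_map_def prod.case by (intro equal_maps_equiv)
qed

theorem extended_centroid_iso: "jp_extended_centroid \<simeq> tkk.lie_extended_centroid"
proof (rule quotient_ring_iso[where r = jp_map_equiv and s = tkk.lie_map_equiv and \<phi> = tkk_map
      and m = jp_map_mult and m' = tkk.lie_map_mult and p = jp_map_add and p' = tkk.lie_map_add
      and e = "((id, id), (UNIV, UNIV))" and e' = "(id, tkk_carrier)"])
  show "jp_map_equiv \<subseteq> jp_permissible \<times> jp_permissible"
    unfolding jp_map_equiv_def by auto
  show "equiv tkk.lie_permissible tkk.lie_map_equiv"
    by (rule tkk.equiv_lie_map_equiv)
  show "(m, n) \<in> jp_map_equiv \<longleftrightarrow> (tkk_map m, tkk_map n) \<in> tkk.lie_map_equiv"
    if "m \<in> jp_permissible" "n \<in> jp_permissible" for m n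
    using that tkk_map_equiv_iff by (metis surj_pair)
  show "\<exists>m\<in>jp_permissible. (tkk_map m, z) \<in> tkk.lie_map_equiv" if "z \<in> tkk.lie_permissible" for z
    using that parts_maps_permissible tkk_map_surjective by (metis surj_pair)
qed (simp_all add: jp_extended_centroid_def tkk.lie_extended_centroid_def tkk_map_in_permissible
    jp_permissible_id tkk_map_id tkk_map_add tkk_map_mult tkk.lie_map_add_congruent tkk.lie_map_mult_congruent)

end

theorem theorem3p8:
  fixes sp :: "'r::comm_ring_1 \<Rightarrow> 'a::ab_group_add \<Rightarrow> 'a"
    and sm :: "'r \<Rightarrow> 'b::ab_group_add \<Rightarrow> 'b"
    and Qp :: "'a \<Rightarrow> 'b \<Rightarrow> 'a"
    and Qm :: "'b \<Rightarrow> 'a \<Rightarrow> 'b"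
  assumes "\<exists>half::'r. 2 * half = 1"
    and "nondegenerate_jordan_pair sp sm Qp Qm"
  shows "jordan_pair.jp_extended_centroid sp sm Qp Qm \<simeq>
    lie_algebra.lie_extended_centroid
      (jordan_pair.tkk_scale sp sm)
      (jordan_pair.tkk_carrier sp sm Qp Qm)
      (jordan_pair.tkk_bracket Qp Qm)"
proof -
  obtain half :: 'r where "2 * half = 1"
    using assms(1) by blast
  then interpret nondegenerate_jordan_pair_half sp sm Qp Qm half
    using assms(2) by (simp add: nondegenerate_jordan_pair_half_def nondegenerate_jordan_pair_half_axioms_def)
  show ?thesis
    by (rule extended_centroid_iso)
qed

end
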